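(* Let $\vec{\xi}$, $\vec{w}$, $A$, $\vec{f}_0$, $\mu_0$ be as described in the context, and let $\vec{x}(\vec{u},t)$, $\vec{u}\in\mathbb{R}^3$, $t\geq 0$, be the solution of the equation with interaction $$d\vec{x}(\vec{u},t)=A\Big(\vec{x}(\vec{u},t)-\int_{\mathbb{R}^3}\vec{x}(\vec{v},t)\,\mu_0(d\vec{v})\Big)dt+d\vec{w}(t),\qquad \vec{x}(\vec{u},0)=\vec{u},\ \vec{u}\in\mathbb{R}^3.$$ For $t\geq0$ let $\vec{\eta}_t$ be the random function $$\vec{\eta}_t(s)=\vec{\xi}\big(\vec{x}(\vec{f}_0(s),t)\big),\qquad s\in[0,2\pi].$$ Then $\{\vec{\eta}_t;\ t\geq0\}$ is a stationary random process in $C^2_p([0,2\pi],\mathbb{R}^3)$.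
   Context: $C^2_p([0,2\pi],\mathbb{R}^3)$ is the set of twice continuously differentiable $2\pi$-periodic functions with values in $\mathbb{R}^3$. $\vec{\xi}=(\xi_1,\xi_2,\xi_3):\mathbb{R}^3\to\mathbb{R}^3$ is a centered Gaussian random field with independent identically distributed coordinates with covariance $E\,\xi_1(\vec{u})\xi_1(\vec{v})=e^{-\|\vec{u}-\vec{v}\|^2}$, $\vec{u},\vec{v}\in\mathbb{R}^3$, taken with infinitely differentiable sample paths. $\vec{w}$ is a standard Wiener process in $\mathbb{R}^3$ (started at $0$), independent of $\vec{\xi}$. $A$ is a real $3\times3$ matrix that generates a group of orthogonal operators: the solution $U_t$ of $dU_t=AU_t\,dt$, $U_0=I$, satisfies $U_t^*=U_t^{-1}$ for all $t\geq0$. $\gamma_0$ is a closed smooth curve in $\mathbb{R}^3$ parametrized by $\vec{f}_0\in C^2_p([0,2\pi],\mathbb{R}^3)$, and $\mu_0$ is its visitation measure, the probability measure $\mu_0(\Delta)=\frac{1}{2\pi}\int_0^{2\pi}\mathbf{1}_\Delta(\vec{f}_0(s))\,ds$, $\Delta\in\mathcal{B}(\mathbb{R}^3)$. Stationary means that for all $\tau\ge 0$ the processes $\{\vec\eta_{t+\tau};t\ge0\}$ and $\{\vec\eta_t;t\ge0\}$ have the same finite-dimensional distributions. *)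

theory Defs
  imports "HOL-Probability.Probability"
begin

subsection \<open>The space of twice continuously differentiable periodic functions\<close>

text \<open>
  A \<open>2\<pi>\<close>-periodic function on \<open>[0, 2\<pi>]\<close> is represented by its periodic extension to the
  whole real line, so that the derivatives at the end points are the two-sided ones.
\<close>

definition C2p :: "(real \<Rightarrow> real ^ 3) set" where
  "C2p = {f. (\<forall>s. f (s + 2 * pi) = f s) \<and>
     (\<exists>f' f''. (\<forall>s. (f has_vector_derivative f' s) (at s)) \<and>
               (\<forall>s. (f' has_vector_derivative f'' s) (at s)) \<and>
               continuous_on UNIV f'')}"

definition vderiv :: "(real \<Rightarrow> real ^ 3) \<Rightarrow> real \<Rightarrow> real ^ 3" where
  "vderiv f s = vector_derivative f (at s)"

definition sup_dist :: "(real \<Rightarrow> real ^ 3) \<Rightarrow> (real \<Rightarrow> real ^ 3) \<Rightarrow> real" where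
  "sup_dist f g = (SUP s\<in>{0..2 * pi}. dist (f s) (g s))"

text \<open>
  The distance of the \<open>C\<^sup>2\<close> norm. It is set to \<open>0\<close> off \<^const>\<open>C2p\<close> because
  \<^locale>\<open>Metric_space\<close> asks for nonnegativity on the whole type.
\<close>

definition C2_dist :: "(real \<Rightarrow> real ^ 3) \<Rightarrow> (real \<Rightarrow> real ^ 3) \<Rightarrow> real" where
  "C2_dist f g = (if f \<in> C2p \<and> g \<in> C2p
     then sup_dist f g + sup_dist (vderiv f) (vderiv g)
          + sup_dist (vderiv (vderiv f)) (vderiv (vderiv g))
     else 0)"

lemma C2p_derivs:
  assumes "f \<in> C2p"
  shows "\<And>s. (f has_vector_derivative vderiv f s) (at s)"
    and "\<And>s. (vderiv f has_vector_derivative vderiv (vderiv f) s) (at s)"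
    and "continuous_on UNIV f" "continuous_on UNIV (vderiv f)"
    and "continuous_on UNIV (vderiv (vderiv f))"
    and "\<And>s. f (s + 2 * pi) = f s"
proof -
  obtain f' f'' where 1: "\<And>s. (f has_vector_derivative f' s) (at s)"
    and 2: "\<And>s. (f' has_vector_derivative f'' s) (at s)" and 3: "continuous_on UNIV f''"
    and per: "\<And>s. f (s + 2 * pi) = f s"
    using assms unfolding C2p_def by blast
  have e1: "vderiv f = f'"
    using 1 by (auto simp: vderiv_def vector_derivative_at)
  have e2: "vderiv f' = f''"
    using 2 by (auto simp: vderiv_def vector_derivative_at)
  show "\<And>s. (f has_vector_derivative vderiv f s) (at s)"
    "\<And>s. (vderiv f has_vector_derivative vderiv (vderiv f) s) (at s)"
    "continuous_on UNIV (vderiv (vderiv f))" "\<And>s. f (s + 2 * pi) = f s"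
    using 1 2 3 per by (simp_all add: e1 e2)
  show "continuous_on UNIV f" "continuous_on UNIV (vderiv f)"
    unfolding e1 using 1 2
    by (meson continuous_at_imp_continuous_on has_vector_derivative_continuous)+
qed

lemma periodic_eqI:
  assumes "\<And>s. h (s + 2 * pi) = h s" "\<And>s. k (s + 2 * pi) = k s"
    and "\<And>s. s \<in> {0..2 * pi} \<Longrightarrow> h s = (k s :: 'a)"
  shows "h = k"
proof -
  have n: "g (s + 2 * pi * real n) = g s" if "\<And>s. g (s + 2 * pi) = g s" for g :: "real \<Rightarrow> 'a" and s n
  proof (induction n)
    case (Suc n)
    have "g (s + 2 * pi * real (Suc n)) = g ((s + 2 * pi * real n) + 2 * pi)"
      by (simp add: algebra_simps)
    then show ?case using that Suc by simp
  qed simp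
  have z: "g (s + 2 * pi * real_of_int i) = g s" if "\<And>s. g (s + 2 * pi) = g s" for g :: "real \<Rightarrow> 'a" and s i
  proof (cases "i \<ge> 0")
    case True
    then show ?thesis using n[of g s "nat i"] that by simp
  next
    case False
    then show ?thesis using n[of g "s + 2 * pi * real_of_int i" "nat (- i)"] that
      by (simp add: algebra_simps)
  qed
  show ?thesis
  proof
    fix s
    define i where "i = \<lfloor>s / (2 * pi)\<rfloor>"
    have "real_of_int i \<le> s / (2 * pi)" "s / (2 * pi) \<le> real_of_int i + 1"
      unfolding i_def by linarith+
    then have "s - 2 * pi * real_of_int i \<in> {0..2 * pi}"
      using pi_gt_zero by (simp add: field_simps)
    then show "h s = k s"
      using assms(3) z[of h "s - 2 * pi * real_of_int i" i, OF assms(1)]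
        z[of k "s - 2 * pi * real_of_int i" i, OF assms(2)] by simp
  qed
qed

lemma sup_dist_bdd:
  assumes "continuous_on UNIV f" "continuous_on UNIV g"
  shows "bdd_above ((\<lambda>s. dist (f s) (g s)) ` {0..2 * pi})"
proof (intro bounded_imp_bdd_above compact_imp_bounded compact_continuous_image)
  show "continuous_on {0..2 * pi} (\<lambda>s. dist (f s) (g s))"
    using assms by (auto intro!: continuous_on_dist intro: continuous_on_subset)
qed simp

lemma sup_dist_upper:
  assumes "continuous_on UNIV f" "continuous_on UNIV g" "s \<in> {0..2 * pi}"
  shows "dist (f s) (g s) \<le> sup_dist f g"
  unfolding sup_dist_def using assms by (intro cSUP_upper sup_dist_bdd)

lemma sup_dist_commute: "sup_dist f g = sup_dist g f"
  by (simp add: sup_dist_def dist_commute)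

lemma sup_dist_same [simp]: "sup_dist f f = 0"
proof -
  have "{0..2 * pi} \<noteq> {}" by simp
  then show ?thesis unfolding sup_dist_def dist_self by (rule cSUP_const)
qed

lemma sup_dist_nonneg:
  assumes "continuous_on UNIV f" "continuous_on UNIV g"
  shows "0 \<le> sup_dist f g"
  using sup_dist_upper[OF assms, of 0] zero_le_dist[of "f 0" "g 0"] by (simp del: zero_le_dist)

lemma sup_dist_triangle:
  assumes "continuous_on UNIV f" "continuous_on UNIV g" "continuous_on UNIV h"
  shows "sup_dist f h \<le> sup_dist f g + sup_dist g h"
proof -
  have "dist (f s) (h s) \<le> sup_dist f g + sup_dist g h" if "s \<in> {0..2 * pi}" for s
    using dist_triangle[of "f s" "h s" "g s"] sup_dist_upper[OF assms(1,2) that]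
      sup_dist_upper[OF assms(2,3) that] by linarith
  then show ?thesis unfolding sup_dist_def[of f h] by (intro cSUP_least) auto
qed

lemma Metric_space_C2p: "Metric_space C2p C2_dist"
proof
  fix f g h
  show "0 \<le> C2_dist f g"
    by (auto simp: C2_dist_def intro!: add_nonneg_nonneg sup_dist_nonneg C2p_derivs)
  show "C2_dist f g = C2_dist g f"
    by (simp add: C2_dist_def sup_dist_commute conj_commute)
  show "C2_dist f g = 0 \<longleftrightarrow> f = g" if fg: "f \<in> C2p" "g \<in> C2p"
  proof
    assume "C2_dist f g = 0"
    moreover have "0 \<le> sup_dist f g" "0 \<le> sup_dist (vderiv f) (vderiv g)"
      "0 \<le> sup_dist (vderiv (vderiv f)) (vderiv (vderiv g))"
      using fg by (auto intro!: sup_dist_nonneg C2p_derivs)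
    ultimately have "sup_dist f g = 0" using fg by (simp add: C2_dist_def)
    then have "f s = g s" if "s \<in> {0..2 * pi}" for s
      using sup_dist_upper[OF C2p_derivs(3)[OF fg(1)] C2p_derivs(3)[OF fg(2)] that] by simp
    then show "f = g"
      by (intro periodic_eqI[of f g] C2p_derivs(6) fg)
  qed (simp add: C2_dist_def)
  show "C2_dist f h \<le> C2_dist f g + C2_dist g h" if "f \<in> C2p" "g \<in> C2p" "h \<in> C2p"
  proof -
    have "sup_dist f h \<le> sup_dist f g + sup_dist g h"
      "sup_dist (vderiv f) (vderiv h) \<le> sup_dist (vderiv f) (vderiv g) + sup_dist (vderiv g) (vderiv h)"
      "sup_dist (vderiv (vderiv f)) (vderiv (vderiv h))
        \<le> sup_dist (vderiv (vderiv f)) (vderiv (vderiv g)) + sup_dist (vderiv (vderiv g)) (vderiv (vderiv h))"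
      using that by (auto intro!: sup_dist_triangle C2p_derivs)
    then show ?thesis using that by (simp add: C2_dist_def)
  qed
qed

definition C2p_borel :: "(real \<Rightarrow> real ^ 3) measure" where
  "C2p_borel = sigma C2p {U. openin (Metric_space.mtopology C2p C2_dist) U}"


subsection \<open>Smoothness\<close>

text \<open>
  \<open>Ck k f\<close>: all iterated partial derivatives of \<open>f\<close> up to order \<open>k\<close> exist and are continuous.
\<close>

primrec Ck :: "nat \<Rightarrow> ('a::euclidean_space \<Rightarrow> 'b::real_normed_vector) \<Rightarrow> bool" where
  "Ck 0 f \<longleftrightarrow> continuous_on UNIV f"
| "Ck (Suc k) f \<longleftrightarrow> (\<forall>x. f differentiable (at x)) \<and>
     (\<forall>b\<in>Basis. Ck k (\<lambda>x. frechet_derivative f (at x) b))"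

definition smooth :: "('a::euclidean_space \<Rightarrow> 'b::real_normed_vector) \<Rightarrow> bool" where
  "smooth f \<longleftrightarrow> (\<forall>k. Ck k f)"


subsection \<open>The Gaussian field and the Wiener process\<close>

text \<open>Degenerate (almost surely constant) variables count as Gaussian.\<close>

definition gaussian_rv :: "'w measure \<Rightarrow> ('w \<Rightarrow> real) \<Rightarrow> bool" where
  "gaussian_rv M X \<longleftrightarrow> X \<in> borel_measurable M \<and>
     (\<exists>m. (AE \<omega> in M. X \<omega> = m) \<or>
          (\<exists>\<sigma>>0. distributed M lborel X (\<lambda>x. ennreal (normal_density m \<sigma> x))))"

definition gaussian_field ::
    "'w measure \<Rightarrow> ('i \<Rightarrow> 'w \<Rightarrow> 'b::euclidean_space) \<Rightarrow> bool" where
  "gaussian_field M \<zeta> \<longleftrightarrow> (\<forall>u. \<zeta> u \<in> borel_measurable M) \<and>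
     (\<forall>I c. finite I \<longrightarrow> gaussian_rv M (\<lambda>\<omega>. \<Sum>u\<in>I. c u \<bullet> \<zeta> u \<omega>))"

text \<open>
  Independence and identical distribution of the coordinates are those of whole random fields,
  seen as random elements of the product space indexed by all points of \<open>\<real>\<^sup>3\<close>.
\<close>

definition xi_field :: "'w measure \<Rightarrow> (real ^ 3 \<Rightarrow> 'w \<Rightarrow> real ^ 3) \<Rightarrow> bool" where
  "xi_field M \<xi> \<longleftrightarrow>
     gaussian_field M \<xi> \<and>
     (\<forall>u. (\<integral>\<omega>. \<xi> u \<omega> \<partial>M) = 0) \<and>
     prob_space.indep_vars M (\<lambda>_. \<Pi>\<^sub>M u\<in>UNIV. borel) (\<lambda>i \<omega> u. \<xi> u \<omega> $ i) UNIV \<and>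
     (\<forall>i j. distr M (\<Pi>\<^sub>M u\<in>UNIV. borel) (\<lambda>\<omega> u. \<xi> u \<omega> $ i)
          = distr M (\<Pi>\<^sub>M u\<in>UNIV. borel) (\<lambda>\<omega> u. \<xi> u \<omega> $ j)) \<and>
     (\<forall>u v. (\<integral>\<omega>. \<xi> u \<omega> $ 1 * \<xi> v \<omega> $ 1 \<partial>M) = exp (- (norm (u - v))\<^sup>2)) \<and>
     (AE \<omega> in M. smooth (\<lambda>u. \<xi> u \<omega>))"

definition wiener_process :: "'w measure \<Rightarrow> (real \<Rightarrow> 'w \<Rightarrow> real ^ 3) \<Rightarrow> bool" where
  "wiener_process M w \<longleftrightarrow>
     (\<forall>t\<ge>0. w t \<in> borel_measurable M) \<and>
     (AE \<omega> in M. w 0 \<omega> = 0) \<and>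
     (\<forall>s t. 0 \<le> s \<and> s < t \<longrightarrow>
        distributed M lborel (\<lambda>\<omega>. w t \<omega> - w s \<omega>)
          (\<lambda>x. ennreal (\<Prod>i\<in>UNIV. normal_density 0 (sqrt (t - s)) (x $ i)))) \<and>
     (\<forall>(t :: nat \<Rightarrow> real) n. 0 \<le> t 0 \<and> mono t \<longrightarrow>
        prob_space.indep_vars M (\<lambda>_. borel) (\<lambda>k \<omega>. w (t (Suc k)) \<omega> - w (t k) \<omega>) {..<n}) \<and>
     (AE \<omega> in M. continuous_on {0..} (\<lambda>t. w t \<omega>))"

text \<open>
  Stated through the generated \<open>\<sigma>\<close>-algebras, since \<^const>\<open>prob_space.indep_var\<close> needs
  both variables to have the same type.
\<close>

definition indep_field_process ::
    "'w measure \<Rightarrow> (real ^ 3 \<Rightarrow> 'w \<Rightarrow> real ^ 3) \<Rightarrow> (real \<Rightarrow> 'w \<Rightarrow> real ^ 3) \<Rightarrow> bool" where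
  "indep_field_process M \<xi> w \<longleftrightarrow>
     prob_space.indep_set M
       (sets (vimage_algebra (space M) (\<lambda>\<omega> u. \<xi> u \<omega>) (\<Pi>\<^sub>M u\<in>UNIV. borel)))
       (sets (vimage_algebra (space M) (\<lambda>\<omega>. \<lambda>t\<in>{0..}. w t \<omega>) (\<Pi>\<^sub>M t\<in>{0..}. borel)))"


subsection \<open>The equation with interaction\<close>

definition generates_orthogonal_group :: "real ^ 3 ^ 3 \<Rightarrow> bool" where
  "generates_orthogonal_group A \<longleftrightarrow>
     (\<exists>U. U 0 = mat 1 \<and>
          (\<forall>t\<ge>0. (U has_vector_derivative A ** U t) (at t within {0..})) \<and>
          (\<forall>t\<ge>0. orthogonal_matrix (U t)))"

definition visitation_measure :: "(real \<Rightarrow> real ^ 3) \<Rightarrow> (real ^ 3) measure" where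
  "visitation_measure f = distr (uniform_measure lborel {0..2 * pi}) borel f"

text \<open>
  The noise is additive, so the stochastic equation is read pathwise in integral form, outside
  one null set common to all starting points and times. The integrability clauses are explicit
  because the Bochner integral is \<open>0\<close> for non-integrable functions.
\<close>

definition interaction_solution ::
    "'w measure \<Rightarrow> real ^ 3 ^ 3 \<Rightarrow> (real ^ 3) measure \<Rightarrow> (real \<Rightarrow> 'w \<Rightarrow> real ^ 3)
      \<Rightarrow> (real ^ 3 \<Rightarrow> real \<Rightarrow> 'w \<Rightarrow> real ^ 3) \<Rightarrow> bool" where
  "interaction_solution M A \<mu> w x \<longleftrightarrow>
     (\<forall>u. \<forall>t\<ge>0. x u t \<in> borel_measurable M) \<and>
     (AE \<omega> in M.
        (\<forall>u. x u 0 \<omega> = u) \<and>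
        (\<forall>t\<ge>0. integrable \<mu> (\<lambda>v. x v t \<omega>)) \<and>
        (\<forall>u. \<forall>t\<ge>0.
           set_integrable lborel {0..t} (\<lambda>s. A *v (x u s \<omega> - (\<integral>v. x v s \<omega> \<partial>\<mu>))) \<and>
           x u t \<omega> = u + (LINT s:{0..t}|lborel. A *v (x u s \<omega> - (\<integral>v. x v s \<omega> \<partial>\<mu>))) + w t \<omega>))"


subsection \<open>Stationary processes\<close>

definition stationary_process ::
    "'w measure \<Rightarrow> 's measure \<Rightarrow> (real \<Rightarrow> 'w \<Rightarrow> 's) \<Rightarrow> bool" where
  "stationary_process M S Y \<longleftrightarrow>
     (\<forall>t\<ge>0. Y t \<in> M \<rightarrow>\<^sub>M S) \<and>
     (\<forall>\<tau>\<ge>0. \<forall>J. finite J \<and> J \<subseteq> {0..} \<longrightarrow>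
        distr M (\<Pi>\<^sub>M t\<in>J. S) (\<lambda>\<omega>. \<lambda>t\<in>J. Y (t + \<tau>) \<omega>)
      = distr M (\<Pi>\<^sub>M t\<in>J. S) (\<lambda>\<omega>. \<lambda>t\<in>J. Y t \<omega>))"

text \<open>
  Sample path properties and the stochastic equation hold only almost surely, so \<open>\<eta>\<close> is a
  process in \<open>S\<close> up to indistinguishability: outside one null set it agrees, at all times
  simultaneously, with a process all of whose values are random elements of \<open>S\<close>.
\<close>

definition stationary_process_ae ::
    "'w measure \<Rightarrow> 's measure \<Rightarrow> (real \<Rightarrow> 'w \<Rightarrow> 's) \<Rightarrow> bool" where
  "stationary_process_ae M S \<eta> \<longleftrightarrow>
     (\<exists>Y. (AE \<omega> in M. \<forall>t\<ge>0. \<eta> t \<omega> = Y t \<omega>) \<and> stationary_process M S Y)"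

end

theory Submission
  imports Defs
begin

text \<open>
  The curve moves rigidly. The difference of two solutions of the equation with interaction does not
  see the noise or the mean, so it solves the linear equation \<open>d' = A d\<close> and equals \<open>U\<^sub>t (u - v)\<close>;
  averaging over \<open>v\<close> turns this into
  \<open>x(u, t) = m + U\<^sub>t (u - m) + w(t)\<close>, where \<open>m\<close> is the mean of \<open>\<mu>\<^sub>0\<close>,
  almost surely for all \<open>u\<close> and \<open>t\<close> (\<open>interaction_solution_eq\<close>).

  The law of the field \<open>\<xi>\<close> at finitely many points depends on the mutual distances of the points
  only: it is Gaussian and its covariances are functions of these distances. Since \<open>w\<close> is
  independent of \<open>\<xi>\<close>, the field can be evaluated at the points of the moving curve as if they were fixed, and
  an average over \<open>w\<close> remains (\<open>xi_iexp_random\<close>). The distances between the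
  points at the times \<open>t\<^sub>k + \<tau>\<close> do not change when all the points are moved back by \<open>U\<^sub>\<tau>\<^sup>-\<^sup>1\<close> and
  by the shift \<open>m + w(\<tau>)\<close>. By the group property of \<open>U\<close> the points become
  \<open>U\<^sub>t (f\<^sub>0(s) - m) + U\<^sub>\<tau>\<^sup>-\<^sup>1 (w(t + \<tau>) - w(\<tau>))\<close>, and
  \<open>U\<^sub>\<tau>\<^sup>-\<^sup>1 (w(t + \<tau>) - w(\<tau>))\<close> is a Wiener process again, because the increments of \<open>w\<close> are independent,
  stationary and rotation invariant (\<open>wiener_rotated_increments\<close>). So the shift \<open>\<tau>\<close> disappears from
  the characteristic functions (\<open>xi_along_flow_iexp\<close>).

  Two measure-theoretic facts connect characteristic functions with laws on the function space.
  A real-valued process is determined in law by the characteristic functions of its finite linear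
  combinations (\<open>distr_process_eqI\<close>). The Borel sets of the space of curves are generated by the
  evaluations at single points, because that space is separable and its distance is built from
  countable suprema over evaluations and their difference quotients (\<open>measurable_C2p_borelI\<close>); hence the evaluations also determine
  finite-dimensional distributions in the function space (\<open>distr_C2p_process_eqI\<close>).
\<close>

section \<open>Characteristic functions determine laws\<close>

lemma finite_measure_iexp_integrable [intro]:
  assumes "finite_measure M" "S \<in> borel_measurable M"
  shows "integrable M (\<lambda>\<omega>. iexp (S \<omega>))"
proof -
  interpret finite_measure M by fact
  show ?thesis
    using assms(2) by (intro integrable_const_bound[where B = 1]) auto
qed

text \<open>
  Levy's uniqueness theorem speaks of probability measures. Taking \<open>t = 0\<close> shows that both measures
  have the same total mass, so they can be normalised by the same factor.
\<close>

lemma iexp_unique_finite_measure: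
  fixes M :: "'a measure" and N :: "'b measure"
  assumes M: "finite_measure M" and N: "finite_measure N"
    and X [measurable]: "X \<in> borel_measurable M" and Y [measurable]: "Y \<in> borel_measurable N"
    and eq: "\<And>t. (\<integral>\<omega>. iexp (t * X \<omega>) \<partial>M) = (\<integral>\<omega>. iexp (t * Y \<omega>) \<partial>N)"
  shows "distr M borel X = distr N borel Y"
proof -
  interpret M: finite_measure M by fact
  interpret N: finite_measure N by fact
  define r where "r = measure M (space M)"
  have rN: "measure N (space N) = r"
    using eq[of 0] by (simp add: r_def)
  show ?thesis
  proof (cases "r = 0")
    case True
    have "emeasure M A = 0" for A
      using emeasure_space[of M A] M.emeasure_eq_measure[of "space M"] True by (simp add: r_def)
    moreover have "emeasure N A = 0" for A
      using emeasure_space[of N A] N.emeasure_eq_measure[of "space N"] True rN by simp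
    ultimately show ?thesis
      by (intro measure_eqI) (simp_all add: emeasure_distr)
  next
    case False
    then have r: "r > 0" using measure_nonneg[of M "space M"] by (simp add: r_def less_le)
    define M' where "M' = density M (\<lambda>_. ennreal (1 / r))"
    define N' where "N' = density N (\<lambda>_. ennreal (1 / r))"
    have em: "emeasure M' A = ennreal (1 / r) * emeasure M A" if "A \<in> sets M" for A
      using that unfolding M'_def by (simp add: emeasure_density nn_integral_cmult_indicator)
    have en: "emeasure N' A = ennreal (1 / r) * emeasure N A" if "A \<in> sets N" for A
      using that unfolding N'_def by (simp add: emeasure_density nn_integral_cmult_indicator)
    have one: "ennreal (1 / r) * ennreal r = 1"
      using r by (simp flip: ennreal_mult)
    interpret M': prob_space M'
    proof
      have "emeasure M' (space M) = 1"
        using em[of "space M"] one by (simp add: M.emeasure_eq_measure r_def)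
      then show "emeasure M' (space M') = 1" by (simp add: M'_def)
    qed
    interpret N': prob_space N'
    proof
      have "emeasure N' (space N) = 1"
        using en[of "space N"] one by (simp add: N.emeasure_eq_measure rN)
      then show "emeasure N' (space N') = 1" by (simp add: N'_def)
    qed
    have XM [measurable]: "X \<in> borel_measurable M'" and YN [measurable]: "Y \<in> borel_measurable N'"
      by (simp_all add: M'_def N'_def)
    have "char (distr M' borel X) = char (distr N' borel Y)"
    proof
      fix t
      have "char (distr M' borel X) t = (\<integral>\<omega>. iexp (t * X \<omega>) \<partial>M')"
        unfolding char_def by (subst integral_distr) auto
      also have "\<dots> = (1 / r) *\<^sub>R (\<integral>\<omega>. iexp (t * X \<omega>) \<partial>M)"
        unfolding M'_def using r by (subst integral_density) auto
      also have "\<dots> = (1 / r) *\<^sub>R (\<integral>\<omega>. iexp (t * Y \<omega>) \<partial>N)"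
        by (simp only: eq)
      also have "\<dots> = (\<integral>\<omega>. iexp (t * Y \<omega>) \<partial>N')"
        unfolding N'_def using r by (subst integral_density) auto
      also have "\<dots> = char (distr N' borel Y) t"
        unfolding char_def by (subst integral_distr) auto
      finally show "char (distr M' borel X) t = char (distr N' borel Y) t" .
    qed
    then have D: "distr M' borel X = distr N' borel Y"
      by (intro Levy_uniqueness) auto
    show ?thesis
    proof (rule measure_eqI)
      fix A assume "A \<in> sets (distr M borel X)"
      then have A [measurable]: "A \<in> sets borel" by simp
      have "emeasure M' (X -` A \<inter> space M') = emeasure N' (Y -` A \<inter> space N')"
        using arg_cong[OF D, of "\<lambda>D. emeasure D A"] by (simp add: emeasure_distr)
      then have "ennreal (1 / r) * emeasure M (X -` A \<inter> space M)
          = ennreal (1 / r) * emeasure N (Y -` A \<inter> space N)"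
        by (simp add: M'_def N'_def flip: em en)
      then show "emeasure (distr M borel X) A = emeasure (distr N borel Y) A"
        using r by (simp add: emeasure_distr ennreal_mult_cancel_left)
    qed simp
  qed
qed

text \<open>
  A bounded nonnegative weight is absorbed into the measure as a density, which stays finite.
\<close>

lemma iexp_unique_weighted:
  fixes g :: "'a \<Rightarrow> real" and h :: "'b \<Rightarrow> real"
  assumes M: "finite_measure M" and N: "finite_measure N"
    and [measurable]: "X \<in> borel_measurable M" "Y \<in> borel_measurable N"
    and [measurable]: "g \<in> borel_measurable M" "h \<in> borel_measurable N"
    and g: "\<And>\<omega>. 0 \<le> g \<omega>" "\<And>\<omega>. g \<omega> \<le> b" and h: "\<And>\<omega>. 0 \<le> h \<omega>" "\<And>\<omega>. h \<omega> \<le> b"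
    and eq: "\<And>t. (\<integral>\<omega>. g \<omega> *\<^sub>R iexp (t * X \<omega>) \<partial>M) = (\<integral>\<omega>. h \<omega> *\<^sub>R iexp (t * Y \<omega>) \<partial>N)"
    and B [measurable]: "B \<in> sets borel"
  shows "(\<integral>\<omega>. g \<omega> * indicator B (X \<omega>) \<partial>M) = (\<integral>\<omega>. h \<omega> * indicator B (Y \<omega>) \<partial>N)"
proof -
  interpret M: finite_measure M by fact
  interpret N: finite_measure N by fact
  have fin: "finite_measure (density L (\<lambda>\<omega>. ennreal (k \<omega>)))"
    if "finite_measure L" "k \<in> borel_measurable L" "\<And>\<omega>. 0 \<le> k \<omega>" "\<And>\<omega>. k \<omega> \<le> b"
    for L :: "'c measure" and k
  proof (rule finite_measureI)
    interpret L: finite_measure L by fact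
    have "(\<integral>\<^sup>+\<omega>. ennreal (k \<omega>) \<partial>L) \<le> (\<integral>\<^sup>+\<omega>. ennreal b \<partial>L)"
      using that by (intro nn_integral_mono ennreal_leI) auto
    also have "\<dots> < \<infinity>"
      by (simp add: L.emeasure_eq_measure ennreal_mult_less_top)
    finally show "emeasure (density L (\<lambda>\<omega>. ennreal (k \<omega>))) (space (density L (\<lambda>\<omega>. ennreal (k \<omega>)))) \<noteq> \<infinity>"
      using that by (simp add: emeasure_density cong: nn_integral_cong)
  qed
  have "distr (density M (\<lambda>\<omega>. ennreal (g \<omega>))) borel X = distr (density N (\<lambda>\<omega>. ennreal (h \<omega>))) borel Y"
    using g h eq by (intro iexp_unique_finite_measure fin M N) (simp_all add: integral_density)
  then have "(\<integral>x. indicator B x \<partial>distr (density M (\<lambda>\<omega>. ennreal (g \<omega>))) borel X)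
     = (\<integral>x. indicator B x \<partial>distr (density N (\<lambda>\<omega>. ennreal (h \<omega>))) borel Y :: real)"
    by simp
  then show ?thesis
    using g h by (subst (asm) (1 2) integral_distr) (simp_all add: integral_density)
qed

text \<open>
  The integrand on the left carries the complex weight \<open>iexp (S \<omega>)\<close>, which is not a density. Its real
  and imaginary parts become nonnegative after adding \<open>1\<close>, and multiplying \<open>iexp (a * X \<omega>)\<close> by
  \<open>1 + cos (S \<omega>)\<close> or \<open>1 + sin (S \<omega>)\<close> gives a combination of joint characteristic functions of
  \<open>(X, S)\<close>. The uniqueness theorem on the line therefore applies to the weighted measures, and the
  weight \<open>1\<close> can be subtracted again.
\<close>

lemma iexp_unique_restrict:
  fixes M :: "'a measure" and N :: "'b measure"
  assumes M: "finite_measure M" and N: "finite_measure N"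
    and [measurable]: "X \<in> borel_measurable M" "Y \<in> borel_measurable N"
    and [measurable]: "S \<in> borel_measurable M" "T \<in> borel_measurable N"
    and eq: "\<And>a b. (\<integral>\<omega>. iexp (a * X \<omega> + b * S \<omega>) \<partial>M) = (\<integral>\<omega>. iexp (a * Y \<omega> + b * T \<omega>) \<partial>N)"
    and B [measurable]: "B \<in> sets borel"
  shows "(\<integral>\<omega>. indicator B (X \<omega>) *\<^sub>R iexp (S \<omega>) \<partial>M)
       = (\<integral>\<omega>. indicator B (Y \<omega>) *\<^sub>R iexp (T \<omega>) \<partial>N)"
proof -
  interpret M: finite_measure M by fact
  interpret N: finite_measure N by fact
  have iM: "integrable M (\<lambda>\<omega>. iexp (U \<omega>))" if "U \<in> borel_measurable M" for U
    using M that by blast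
  have iN: "integrable N (\<lambda>\<omega>. iexp (U \<omega>))" if "U \<in> borel_measurable N" for U
    using N that by blast
  \<comment> \<open>The weights turn into shifts of the argument of \<open>iexp\<close>.\<close>
  have split_cos: "(1 + cos v) *\<^sub>R iexp u = iexp u + (iexp (u + v) + iexp (u - v)) / 2"
    and split_sin: "(1 + sin v) *\<^sub>R iexp u = iexp u + (iexp (u + v) - iexp (u - v)) / (2 * \<i>)" for u v
    by (simp_all add: complex_eq_iff Re_exp Im_exp Re_divide Im_divide cos_add sin_add cos_diff sin_diff
        power2_eq_square field_simps)
  have e0: "(\<integral>\<omega>. iexp (t * X \<omega>) \<partial>M) = (\<integral>\<omega>. iexp (t * Y \<omega>) \<partial>N)" for t
    using eq[of t 0] by simp
  have e1: "(\<integral>\<omega>. iexp (t * X \<omega> + S \<omega>) \<partial>M) = (\<integral>\<omega>. iexp (t * Y \<omega> + T \<omega>) \<partial>N)" for t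
    using eq[of t 1] by simp
  have e2: "(\<integral>\<omega>. iexp (t * X \<omega> - S \<omega>) \<partial>M) = (\<integral>\<omega>. iexp (t * Y \<omega> - T \<omega>) \<partial>N)" for t
    using eq[of t "-1"] by simp
  have w: "(\<integral>\<omega>. 1 * indicator B (X \<omega>) \<partial>M) = (\<integral>\<omega>. 1 * indicator B (Y \<omega>) \<partial>N :: real)"
    using e0 by (intro iexp_unique_weighted[where b = 1] M N) auto
  have c: "(\<integral>\<omega>. (1 + cos (S \<omega>)) * indicator B (X \<omega>) \<partial>M) = (\<integral>\<omega>. (1 + cos (T \<omega>)) * indicator B (Y \<omega>) \<partial>N)"
  proof (intro iexp_unique_weighted[where b = 2] M N)
    fix t
    show "(\<integral>\<omega>. (1 + cos (S \<omega>)) *\<^sub>R iexp (t * X \<omega>) \<partial>M) = (\<integral>\<omega>. (1 + cos (T \<omega>)) *\<^sub>R iexp (t * Y \<omega>) \<partial>N)"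
      unfolding split_cos by (simp add: iM iN e0 e1 e2 del: of_real_add of_real_mult of_real_diff)
  qed (auto, (smt (verit) cos_ge_minus_one cos_le_one)+)
  have s: "(\<integral>\<omega>. (1 + sin (S \<omega>)) * indicator B (X \<omega>) \<partial>M) = (\<integral>\<omega>. (1 + sin (T \<omega>)) * indicator B (Y \<omega>) \<partial>N)"
  proof (intro iexp_unique_weighted[where b = 2] M N)
    fix t
    show "(\<integral>\<omega>. (1 + sin (S \<omega>)) *\<^sub>R iexp (t * X \<omega>) \<partial>M) = (\<integral>\<omega>. (1 + sin (T \<omega>)) *\<^sub>R iexp (t * Y \<omega>) \<partial>N)"
      unfolding split_sin by (simp add: iM iN e0 e1 e2 del: of_real_add of_real_mult of_real_diff)
  qed (auto, (smt (verit) sin_ge_minus_one sin_le_one)+)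
  have bM: "integrable M (\<lambda>\<omega>. k \<omega> * indicator B (X \<omega>) :: real)" if "k \<in> borel_measurable M" "\<And>\<omega>. \<bar>k \<omega>\<bar> \<le> 1" for k
    using that by (intro M.integrable_const_bound[where B = 1]) (auto simp: indicator_def)
  have bN: "integrable N (\<lambda>\<omega>. k \<omega> * indicator B (Y \<omega>) :: real)" if "k \<in> borel_measurable N" "\<And>\<omega>. \<bar>k \<omega>\<bar> \<le> 1" for k
    using that by (intro N.integrable_const_bound[where B = 1]) (auto simp: indicator_def)
  have iM': "integrable M (\<lambda>\<omega>. indicator B (X \<omega>) *\<^sub>R iexp (S \<omega>))"
    by (intro M.integrable_const_bound[where B = 1]) (auto simp: indicator_def)
  have iN': "integrable N (\<lambda>\<omega>. indicator B (Y \<omega>) *\<^sub>R iexp (T \<omega>))"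
    by (intro N.integrable_const_bound[where B = 1]) (auto simp: indicator_def)
  have c': "(\<integral>\<omega>. cos (S \<omega>) * indicator B (X \<omega>) \<partial>M) = (\<integral>\<omega>. cos (T \<omega>) * indicator B (Y \<omega>) \<partial>N)"
    using c w bM[of "\<lambda>_. 1"] bN[of "\<lambda>_. 1"] bM[of "\<lambda>\<omega>. cos (S \<omega>)"] bN[of "\<lambda>\<omega>. cos (T \<omega>)"]
    by (simp add: distrib_right)
  have s': "(\<integral>\<omega>. sin (S \<omega>) * indicator B (X \<omega>) \<partial>M) = (\<integral>\<omega>. sin (T \<omega>) * indicator B (Y \<omega>) \<partial>N)"
    using s w bM[of "\<lambda>_. 1"] bN[of "\<lambda>_. 1"] bM[of "\<lambda>\<omega>. sin (S \<omega>)"] bN[of "\<lambda>\<omega>. sin (T \<omega>)"]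
    by (simp add: distrib_right)
  show ?thesis
  proof (rule complex_eqI)
    show "Re (\<integral>\<omega>. indicator B (X \<omega>) *\<^sub>R iexp (S \<omega>) \<partial>M) = Re (\<integral>\<omega>. indicator B (Y \<omega>) *\<^sub>R iexp (T \<omega>) \<partial>N)"
      using c' by (simp add: integral_Re[OF iM', symmetric] integral_Re[OF iN', symmetric] Re_exp mult.commute)
    show "Im (\<integral>\<omega>. indicator B (X \<omega>) *\<^sub>R iexp (S \<omega>) \<partial>M) = Im (\<integral>\<omega>. indicator B (Y \<omega>) *\<^sub>R iexp (T \<omega>) \<partial>N)"
      using s' by (simp add: integral_Im[OF iM', symmetric] integral_Im[OF iN', symmetric] Im_exp mult.commute)
  qed
qed

text \<open>
  Uniqueness for several variables is reduced to one variable by induction. Restricting the measures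
  to the event that one variable lies in its Borel set keeps the characteristic functions of
  the remaining variables equal, by \<open>iexp_unique_restrict\<close>. The induction ranges over all finite
  measures, since the restricted measures are not probabilities.
\<close>

lemma emeasure_eq_if_iexp_eq:
  fixes M :: "'a measure" and N :: "'b measure" and K :: "'i set"
  assumes "finite K" "finite_measure M" "finite_measure N"
    and "\<And>i. i \<in> K \<Longrightarrow> X i \<in> borel_measurable M" "\<And>i. i \<in> K \<Longrightarrow> Y i \<in> borel_measurable N"
    and "\<And>c. (\<integral>\<omega>. iexp (\<Sum>i\<in>K. c i * X i \<omega>) \<partial>M) = (\<integral>\<omega>. iexp (\<Sum>i\<in>K. c i * Y i \<omega>) \<partial>N)"
    and "\<And>i. i \<in> K \<Longrightarrow> B i \<in> sets borel"
  shows "emeasure M {\<omega>\<in>space M. \<forall>i\<in>K. X i \<omega> \<in> B i} = emeasure N {\<omega>\<in>space N. \<forall>i\<in>K. Y i \<omega> \<in> B i}"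
  using assms
proof (induction K arbitrary: M N rule: finite_induct)
  case empty
  interpret M: finite_measure M by fact
  interpret N: finite_measure N by fact
  show ?case
    using empty.prems(5)[of undefined] by (simp add: M.emeasure_eq_measure N.emeasure_eq_measure)
next
  case (insert j K)
  interpret M: finite_measure M by fact
  interpret N: finite_measure N by fact
  note [measurable] = insert.prems(3,4)[OF insertI2] insert.prems(3,4)[OF insertI1]
    insert.prems(6)[OF insertI1] insert.prems(6)[OF insertI2]
  define M' where "M' = density M (\<lambda>\<omega>. ennreal (indicator (B j) (X j \<omega>)))"
  define N' where "N' = density N (\<lambda>\<omega>. ennreal (indicator (B j) (Y j \<omega>)))"
  have em: "emeasure M' A = emeasure M {\<omega>\<in>A. X j \<omega> \<in> B j}" if [measurable]: "A \<in> sets M" for A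
  proof -
    have "emeasure M' A = (\<integral>\<^sup>+\<omega>. indicator (B j) (X j \<omega>) * indicator A \<omega> \<partial>M)"
      unfolding M'_def by (subst emeasure_density) (auto simp: ennreal_indicator)
    also have "\<dots> = (\<integral>\<^sup>+\<omega>. indicator {\<omega>\<in>A. X j \<omega> \<in> B j} \<omega> \<partial>M)"
      by (intro nn_integral_cong) (auto simp: indicator_def)
    also have "\<dots> = emeasure M {\<omega>\<in>A. X j \<omega> \<in> B j}"
      using sets.sets_into_space[OF that] by (intro nn_integral_indicator) measurable
    finally show ?thesis .
  qed
  have en: "emeasure N' A = emeasure N {\<omega>\<in>A. Y j \<omega> \<in> B j}" if [measurable]: "A \<in> sets N" for A
  proof -
    have "emeasure N' A = (\<integral>\<^sup>+\<omega>. indicator (B j) (Y j \<omega>) * indicator A \<omega> \<partial>N)"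
      unfolding N'_def by (subst emeasure_density) (auto simp: ennreal_indicator)
    also have "\<dots> = (\<integral>\<^sup>+\<omega>. indicator {\<omega>\<in>A. Y j \<omega> \<in> B j} \<omega> \<partial>N)"
      by (intro nn_integral_cong) (auto simp: indicator_def)
    also have "\<dots> = emeasure N {\<omega>\<in>A. Y j \<omega> \<in> B j}"
      using sets.sets_into_space[OF that] by (intro nn_integral_indicator) measurable
    finally show ?thesis .
  qed
  have sM: "space M' = space M" "sets M' = sets M" and sN: "space N' = space N" "sets N' = sets N"
    by (simp_all add: M'_def N'_def)
  have fM: "finite_measure M'"
    by (rule finite_measureI) (simp add: sM em M.emeasure_eq_measure)
  have fN: "finite_measure N'"
    by (rule finite_measureI) (simp add: sN en N.emeasure_eq_measure)
  have eq: "(\<integral>\<omega>. iexp (\<Sum>i\<in>K. c i * X i \<omega>) \<partial>M') = (\<integral>\<omega>. iexp (\<Sum>i\<in>K. c i * Y i \<omega>) \<partial>N')" for c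
  proof -
    have "(\<integral>\<omega>. indicator (B j) (X j \<omega>) *\<^sub>R iexp (\<Sum>i\<in>K. c i * X i \<omega>) \<partial>M)
        = (\<integral>\<omega>. indicator (B j) (Y j \<omega>) *\<^sub>R iexp (\<Sum>i\<in>K. c i * Y i \<omega>) \<partial>N)"
    proof (rule iexp_unique_restrict)
      fix a b
      have sums: "(\<Sum>i\<in>insert j K. (if i = j then a else b * c i) * Z i) = a * Z j + b * (\<Sum>i\<in>K. c i * Z i)" for Z :: "'i \<Rightarrow> real"
        using insert.hyps by (auto simp: sum_distrib_left mult.assoc intro!: sum.cong)
      show "(\<integral>\<omega>. iexp (a * X j \<omega> + b * (\<Sum>i\<in>K. c i * X i \<omega>)) \<partial>M)
          = (\<integral>\<omega>. iexp (a * Y j \<omega> + b * (\<Sum>i\<in>K. c i * Y i \<omega>)) \<partial>N)"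
        using insert.prems(5)[of "\<lambda>i. if i = j then a else b * c i"] unfolding sums .
    qed (use insert.prems in measurable)
    moreover have "(\<integral>\<omega>. iexp (\<Sum>i\<in>K. c i * X i \<omega>) \<partial>M') = (\<integral>\<omega>. indicator (B j) (X j \<omega>) *\<^sub>R iexp (\<Sum>i\<in>K. c i * X i \<omega>) \<partial>M)"
      unfolding M'_def
      using integral_density[of "\<lambda>\<omega>. iexp (\<Sum>i\<in>K. c i * X i \<omega>)" M "\<lambda>\<omega>. indicator (B j) (X j \<omega>)"]
      by simp
    moreover have "(\<integral>\<omega>. iexp (\<Sum>i\<in>K. c i * Y i \<omega>) \<partial>N') = (\<integral>\<omega>. indicator (B j) (Y j \<omega>) *\<^sub>R iexp (\<Sum>i\<in>K. c i * Y i \<omega>) \<partial>N)"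
      unfolding N'_def
      using integral_density[of "\<lambda>\<omega>. iexp (\<Sum>i\<in>K. c i * Y i \<omega>)" N "\<lambda>\<omega>. indicator (B j) (Y j \<omega>)"]
      by simp
    ultimately show ?thesis by simp
  qed
  have "emeasure M' {\<omega>\<in>space M'. \<forall>i\<in>K. X i \<omega> \<in> B i} = emeasure N' {\<omega>\<in>space N'. \<forall>i\<in>K. Y i \<omega> \<in> B i}"
    using insert.prems by (intro insert.IH fM fN eq) (auto simp: M'_def N'_def)
  moreover have "{\<omega>\<in>space M. \<forall>i\<in>K. X i \<omega> \<in> B i} \<in> sets M" "{\<omega>\<in>space N. \<forall>i\<in>K. Y i \<omega> \<in> B i} \<in> sets N"
    using insert.hyps(1) by measurable
  ultimately have "emeasure M {\<omega> \<in> {\<omega>\<in>space M. \<forall>i\<in>K. X i \<omega> \<in> B i}. X j \<omega> \<in> B j}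
      = emeasure N {\<omega> \<in> {\<omega>\<in>space N. \<forall>i\<in>K. Y i \<omega> \<in> B i}. Y j \<omega> \<in> B j}"
    by (simp add: sM sN em en)
  moreover have "{\<omega> \<in> {\<omega>\<in>space M. \<forall>i\<in>K. X i \<omega> \<in> B i}. X j \<omega> \<in> B j} = {\<omega>\<in>space M. \<forall>i\<in>insert j K. X i \<omega> \<in> B i}"
    "{\<omega> \<in> {\<omega>\<in>space N. \<forall>i\<in>K. Y i \<omega> \<in> B i}. Y j \<omega> \<in> B j} = {\<omega>\<in>space N. \<forall>i\<in>insert j K. Y i \<omega> \<in> B i}"
    by auto
  ultimately show ?case by simp
qed

lemma distr_process_eqI:
  fixes M :: "'a measure" and N :: "'b measure" and I :: "'i set"
  assumes M: "finite_measure M" and N: "finite_measure N"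
    and X: "\<And>i. i \<in> I \<Longrightarrow> X i \<in> borel_measurable M" and Y: "\<And>i. i \<in> I \<Longrightarrow> Y i \<in> borel_measurable N"
    and eq: "\<And>K c. finite K \<Longrightarrow> K \<subseteq> I \<Longrightarrow>
      (\<integral>\<omega>. iexp (\<Sum>i\<in>K. c i * X i \<omega>) \<partial>M) = (\<integral>\<omega>. iexp (\<Sum>i\<in>K. c i * Y i \<omega>) \<partial>N)"
  shows "distr M (\<Pi>\<^sub>M i\<in>I. borel) (\<lambda>\<omega>. \<lambda>i\<in>I. X i \<omega>) = distr N (\<Pi>\<^sub>M i\<in>I. borel) (\<lambda>\<omega>. \<lambda>i\<in>I. Y i \<omega>)"
proof -
  have mX [measurable]: "(\<lambda>\<omega>. \<lambda>i\<in>I. X i \<omega>) \<in> M \<rightarrow>\<^sub>M (\<Pi>\<^sub>M i\<in>I. borel)"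
    using X by (intro measurable_restrict)
  have mY [measurable]: "(\<lambda>\<omega>. \<lambda>i\<in>I. Y i \<omega>) \<in> N \<rightarrow>\<^sub>M (\<Pi>\<^sub>M i\<in>I. borel)"
    using Y by (intro measurable_restrict)
  show ?thesis
  proof (rule measure_eqI_PiM_infinite)
    show "finite_measure (distr M (\<Pi>\<^sub>M i\<in>I. borel) (\<lambda>\<omega>. \<lambda>i\<in>I. X i \<omega>))"
      by (intro finite_measure.finite_measure_distr M mX)
  next
    fix A :: "'i \<Rightarrow> real set" and J
    assume J: "finite J" "J \<subseteq> I" and A: "\<And>i. i \<in> J \<Longrightarrow> A i \<in> sets borel"
    have set: "prod_emb I (\<lambda>_. borel) J (Pi\<^sub>E J A) \<in> sets (\<Pi>\<^sub>M i\<in>I. (borel :: real measure))"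
      using J A by (intro sets_PiM_I) auto
    have pre: "(\<lambda>\<omega>. \<lambda>i\<in>I. Z i \<omega>) -` prod_emb I (\<lambda>_. borel) J (Pi\<^sub>E J A) \<inter> space L
        = {\<omega>\<in>space L. \<forall>i\<in>J. Z i \<omega> \<in> A i}" for Z :: "'i \<Rightarrow> 'c \<Rightarrow> real" and L :: "'c measure"
      using J(2) by (auto simp: prod_emb_def PiE_iff restrict_def extensional_def subset_eq)
    show "emeasure (distr M (\<Pi>\<^sub>M i\<in>I. borel) (\<lambda>\<omega>. \<lambda>i\<in>I. X i \<omega>)) (prod_emb I (\<lambda>_. borel) J (Pi\<^sub>E J A))
        = emeasure (distr N (\<Pi>\<^sub>M i\<in>I. borel) (\<lambda>\<omega>. \<lambda>i\<in>I. Y i \<omega>)) (prod_emb I (\<lambda>_. borel) J (Pi\<^sub>E J A))"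
      unfolding emeasure_distr[OF mX set] emeasure_distr[OF mY set] pre
      using J X Y A by (intro emeasure_eq_if_iexp_eq M N eq) auto
  qed simp_all
qed

section \<open>The equation with interaction\<close>

lemma inner_orthogonal_matrix:
  fixes Q :: "real ^ 'n ^ 'n"
  assumes "orthogonal_matrix Q"
  shows "(Q *v u) \<bullet> (Q *v v) = u \<bullet> v"
proof -
  have "orthogonal_transformation ((*v) Q)"
    using assms by (simp add: orthogonal_transformation_matrix matrix_vector_mul_linear)
  then show ?thesis by (simp add: orthogonal_transformation_def)
qed

lemma norm_orthogonal_matrix:
  fixes Q :: "real ^ 'n ^ 'n"
  assumes "orthogonal_matrix Q"
  shows "norm (Q *v u) = norm u"
  using inner_orthogonal_matrix[OF assms, of u u] by (simp add: norm_eq_sqrt_inner)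

text \<open>
  The matrices \<open>exp (t A)\<close>, characterised by their differential equation and assumed orthogonal.
\<close>

definition orthogonal_flow :: "real ^ 'n ^ 'n \<Rightarrow> (real \<Rightarrow> real ^ 'n ^ 'n) \<Rightarrow> bool" where
  "orthogonal_flow A U \<longleftrightarrow> U 0 = mat 1 \<and>
     (\<forall>t\<ge>0. (U has_vector_derivative A ** U t) (at t within {0..})) \<and> (\<forall>t\<ge>0. orthogonal_matrix (U t))"

lemma bounded_linear_matrix_apply: "bounded_linear (\<lambda>M :: real ^ 'n ^ 'm. M *v u)"
  unfolding linear_conv_bounded_linear[symmetric] linear_iff
  by (simp add: matrix_vector_mult_add_rdistrib scaleR_matrix_vector_assoc)

context
  fixes A :: "real ^ 'n ^ 'n" and U
  assumes flow: "orthogonal_flow A U"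
begin

lemma flow_zero: "U 0 *v u = u"
  and flow_orthogonal: "t \<ge> 0 \<Longrightarrow> orthogonal_matrix (U t)"
  using flow by (simp_all add: orthogonal_flow_def)

lemma flow_derivative:
  assumes "t \<ge> 0"
  shows "((\<lambda>t. U t *v u) has_vector_derivative A *v (U t *v u)) (at t within {0..})"
  using bounded_linear.has_vector_derivative[OF bounded_linear_matrix_apply, of U "A ** U t" _ u] flow assms
  by (auto simp: orthogonal_flow_def matrix_vector_mul_assoc)

text \<open>
  Derivative at \<open>0\<close> of the constant function \<open>t \<mapsto> (U t *v u) \<bullet> (U t *v v)\<close>.
\<close>

lemma generator_skew: "(A *v u) \<bullet> v + u \<bullet> (A *v v) = 0"
proof -
  have "((\<lambda>t. (U t *v u) \<bullet> (U t *v v)) has_vector_derivative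
      (U 0 *v u) \<bullet> (A *v (U 0 *v v)) + (A *v (U 0 *v u)) \<bullet> (U 0 *v v)) (at 0 within {0..})"
    by (intro bounded_bilinear.has_vector_derivative[OF bounded_bilinear_inner] flow_derivative) simp_all
  then have 1: "((\<lambda>t. (U t *v u) \<bullet> (U t *v v)) has_vector_derivative u \<bullet> (A *v v) + (A *v u) \<bullet> v) (at 0 within {0..})"
    by (simp add: flow_zero)
  have 2: "((\<lambda>t. (U t *v u) \<bullet> (U t *v v)) has_vector_derivative 0) (at 0 within {0..})"
    by (rule has_vector_derivative_transform[OF _ _ has_vector_derivative_const[of "u \<bullet> v"]])
      (auto simp: inner_orthogonal_matrix flow_orthogonal)
  have "at 0 within {0::real..} \<noteq> bot"
    by (simp add: trivial_limit_at_right_real at_within_Ici_at_right)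
  from vector_derivative_unique_within[OF this 1 2] show ?thesis by simp
qed

text \<open>
  Skew symmetry makes the squared distance of two solutions constant.
\<close>

lemma linear_ode_unique:
  assumes d: "\<And>t. t \<in> {0..T} \<Longrightarrow> (d has_vector_derivative A *v d t) (at t within {0..T})"
    and e: "\<And>t. t \<in> {0..T} \<Longrightarrow> (e has_vector_derivative A *v e t) (at t within {0..T})"
    and "d 0 = e 0" and t: "t \<in> {0..T}"
  shows "d t = e t"
proof -
  define q where "q t = (d t - e t) \<bullet> (d t - e t)" for t
  have q: "(q has_vector_derivative 0) (at t within {0..T})" if "t \<in> {0..T}" for t
  proof -
    have "(q has_vector_derivative (d t - e t) \<bullet> (A *v d t - A *v e t) + (A *v d t - A *v e t) \<bullet> (d t - e t)) (at t within {0..T})"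
      unfolding q_def
      by (intro bounded_bilinear.has_vector_derivative[OF bounded_bilinear_inner]
          has_vector_derivative_diff d e that)
    then show ?thesis
      using generator_skew[of "d t - e t" "d t - e t"]
      by (simp add: matrix_vector_mult_diff_distrib add.commute)
  qed
  obtain c where c: "\<And>s. s \<in> {0..T} \<Longrightarrow> q s = c"
    using has_vector_derivative_zero_constant[of "{0..T}" q] q by auto
  have "q t = q 0" using c[OF t] c[of 0] t by simp
  then show ?thesis using \<open>d 0 = e 0\<close> by (simp add: q_def)
qed

lemma flow_add:
  assumes "0 \<le> s" "0 \<le> t"
  shows "U (t + s) *v u = U t *v (U s *v u)"
proof (rule linear_ode_unique[of t "\<lambda>t. U (t + s) *v u"])
  fix r assume r: "r \<in> {0..t}"
  have "((\<lambda>t. U t *v u) has_vector_derivative A *v (U (r + s) *v u)) (at (r + s) within (\<lambda>t. t + s) ` {0..t})"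
    using r assms by (intro has_vector_derivative_within_subset[OF flow_derivative]) auto
  then have "((\<lambda>t. U t *v u) \<circ> (\<lambda>t. t + s) has_vector_derivative 1 *\<^sub>R (A *v (U (r + s) *v u))) (at r within {0..t})"
    by (intro vector_diff_chain_within) (auto intro!: derivative_eq_intros)
  then show "((\<lambda>t. U (t + s) *v u) has_vector_derivative A *v (U (r + s) *v u)) (at r within {0..t})"
    by (simp add: comp_def)
  show "((\<lambda>t. U t *v (U s *v u)) has_vector_derivative A *v (U r *v (U s *v u))) (at r within {0..t})"
    using r by (intro has_vector_derivative_within_subset[OF flow_derivative]) auto
qed (use assms in \<open>auto simp: flow_zero\<close>)

text \<open>
  The noise and the mean cancel in the difference of two solutions, which is therefore given by the
  flow. Averaging that difference over \<open>\<mu>\<close> yields the deviation of a solution from the mean without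
  interchanging integrals over time and space. The drift is then known explicitly
  and is the derivative of \<open>U t *v (u - m)\<close>.
\<close>

lemma interaction_solution_eq:
  fixes X :: "real ^ 'n \<Rightarrow> real \<Rightarrow> real ^ 'n" and \<mu> :: "(real ^ 'n) measure"
  defines "m \<equiv> \<integral>v. v \<partial>\<mu>"
  assumes \<mu>: "prob_space \<mu>"
    and X0: "\<And>u. X u 0 = u"
    and int: "\<And>t. t \<ge> 0 \<Longrightarrow> integrable \<mu> (\<lambda>v. X v t)"
    and sint: "\<And>u t. t \<ge> 0 \<Longrightarrow> set_integrable lborel {0..t} (\<lambda>s. A *v (X u s - (\<integral>v. X v s \<partial>\<mu>)))"
    and X: "\<And>u t. t \<ge> 0 \<Longrightarrow> X u t = u + (LINT s:{0..t}|lborel. A *v (X u s - (\<integral>v. X v s \<partial>\<mu>))) + W t"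
    and t: "t \<ge> 0"
  shows "X u t = m + U t *v (u - m) + W t"
proof -
  interpret \<mu>: prob_space \<mu> by fact
  have diff: "X u t - X v t = U t *v (u - v)" if t: "t \<ge> 0" for u v t
  proof (rule linear_ode_unique[where d = "\<lambda>t. X u t - X v t" and T = t])
    \<comment> \<open>The integral equation makes the difference continuous, hence the integrand continuous, hence the
      difference differentiable.\<close>
    define g where "g s = A *v (X u s - X v s)" for s
    have g: "g s = A *v (X u s - (\<integral>v. X v s \<partial>\<mu>)) - A *v (X v s - (\<integral>v. X v s \<partial>\<mu>))" for s
      by (simp add: g_def flip: matrix_vector_mult_diff_distrib)
    have gi: "set_integrable lborel {0..t} g" if "t \<ge> 0" for t
      unfolding g using sint that by (intro set_integral_diff) auto
    have d: "X u r - X v r = u - v + integral {0..r} g" if "r \<ge> 0" for r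
    proof -
      have "X u r - X v r = u - v + (LINT s:{0..r}|lborel. g s)"
        using that sint unfolding g by (subst set_integral_diff) (auto simp: X[of r u] X[of r v])
      then show ?thesis using set_borel_integral_eq_integral[OF gi[OF that]] by simp
    qed
    have "continuous_on {0..t} (\<lambda>r. u - v + integral {0..r} g)"
      using set_borel_integral_eq_integral[OF gi[OF t]]
      by (intro continuous_intros indefinite_integral_continuous_1)
    then have cont: "continuous_on {0..t} (\<lambda>r. X u r - X v r)"
      using d by (subst continuous_on_cong[OF refl]) auto
    have gc: "continuous_on {0..t} g"
      unfolding g_def
      by (intro linear_continuous_on_compose[OF cont]) (simp add: matrix_vector_mul_linear)
    fix r assume r: "r \<in> {0..t}"
    have "((\<lambda>r. u - v + integral {0..r} g) has_vector_derivative 0 + g r) (at r within {0..t})" (is "?D (0 + g r)")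
      by (rule has_vector_derivative_add[OF has_vector_derivative_const integral_has_vector_derivative[OF gc r]])
    then have "?D (g r)" by simp
    then have "((\<lambda>r. X u r - X v r) has_vector_derivative g r) (at r within {0..t})"
      by (rule has_vector_derivative_transform[OF r, rotated]) (auto intro: d)
    then show "((\<lambda>r. X u r - X v r) has_vector_derivative A *v (X u r - X v r)) (at r within {0..t})"
      unfolding g_def .
    show "((\<lambda>t. U t *v (u - v)) has_vector_derivative A *v (U r *v (u - v))) (at r within {0..t})"
      using r by (intro has_vector_derivative_within_subset[OF flow_derivative]) auto
  qed (use t in \<open>auto simp: X0 flow_zero\<close>)
  have im: "integrable \<mu> (\<lambda>v. v)" using int[of 0] by (simp add: X0)
  have mean: "X u s - (\<integral>v. X v s \<partial>\<mu>) = U s *v (u - m)" if "s \<ge> 0" for s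
  proof -
    have "X u s - (\<integral>v. X v s \<partial>\<mu>) = (\<integral>v. X u s - X v s \<partial>\<mu>)"
      using int[OF that] by (simp add: \<mu>.prob_space)
    also have "\<dots> = (\<integral>v. U s *v (u - v) \<partial>\<mu>)" using diff[OF that] by simp
    also have "\<dots> = U s *v (\<integral>v. u - v \<partial>\<mu>)"
      using im by (intro integral_bounded_linear) (auto simp: matrix_vector_mul_bounded_linear)
    also have "(\<integral>v. u - v \<partial>\<mu>) = u - m" using im by (simp add: m_def \<mu>.prob_space)
    finally show ?thesis .
  qed
  have "(LINT s:{0..t}|lborel. A *v (X u s - (\<integral>v. X v s \<partial>\<mu>)))
      = integral {0..t} (\<lambda>s. A *v (X u s - (\<integral>v. X v s \<partial>\<mu>)))"
    using set_borel_integral_eq_integral(2)[OF sint[OF t]] .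
  also have "\<dots> = integral {0..t} (\<lambda>s. A *v (U s *v (u - m)))"
    by (intro Henstock_Kurzweil_Integration.integral_cong) (simp add: mean)
  also have "\<dots> = U t *v (u - m) - U 0 *v (u - m)"
  proof (intro integral_unique fundamental_theorem_of_calculus t)
    fix s assume "s \<in> {0..t}"
    then show "((\<lambda>t. U t *v (u - m)) has_vector_derivative A *v (U s *v (u - m))) (at s within {0..t})"
      by (intro has_vector_derivative_within_subset[OF flow_derivative]) auto
  qed
  finally show ?thesis using X[OF t, of u] by (simp add: flow_zero)
qed

end

lemma prob_space_visitation_measure:
  assumes "f \<in> C2p"
  shows "prob_space (visitation_measure f)"
proof -
  have "f \<in> borel_measurable borel"
    using C2p_derivs(3)[OF assms] by (rule borel_measurable_continuous_onI)
  then show ?thesis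
    unfolding visitation_measure_def
    by (intro prob_space.prob_space_distr prob_space_uniform_measure) auto
qed

section \<open>Rotated increments of the Wiener process\<close>

lemma borel_measurable_matrix_vector_mult:
  fixes Q :: "real ^ 'n ^ 'm"
  shows "(*v) Q \<in> borel_measurable borel"
  by (simp add: borel_measurable_continuous_onI matrix_vector_mult_linear_continuous_on)

lemma distr_lborel_orthogonal_matrix:
  fixes Q :: "real ^ ('n :: {finite, wellorder}) ^ ('n :: {finite, wellorder})"
  assumes Q: "orthogonal_matrix Q"
  shows "distr lborel borel ((*v) Q) = lborel"
proof (rule lborel_eqI[symmetric])
  fix l u :: "real ^ ('n :: {finite, wellorder})" assume le: "\<And>b. b \<in> Basis \<Longrightarrow> l \<bullet> b \<le> u \<bullet> b"
  have inv: "Q ** transpose Q = mat 1" "transpose Q ** Q = mat 1"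
    using Q by (auto simp: orthogonal_matrix_def)
  have vim: "(*v) Q -` box l u = (*v) (transpose Q) ` box l u"
  proof (intro set_eqI iffI)
    fix x assume "x \<in> (*v) Q -` box l u"
    then show "x \<in> (*v) (transpose Q) ` box l u"
      by (intro image_eqI[of _ _ "Q *v x"]) (auto simp: matrix_vector_mul_assoc inv simp del: transpose_matrix_vector)
  qed (auto simp: matrix_vector_mul_assoc inv simp del: transpose_matrix_vector)
  have T: "orthogonal_transformation ((*v) (transpose Q))"
    using Q by (simp add: orthogonal_transformation_matrix matrix_vector_mul_linear)
  have box: "box l u \<in> lmeasurable" by simp
  have B: "(*v) Q -` box l u \<in> sets borel"
    using measurable_sets[OF borel_measurable_matrix_vector_mult, of "box l u" Q] by simp
  have "emeasure (distr lborel borel ((*v) Q)) (box l u) = emeasure lborel ((*v) Q -` box l u)"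
    by (subst emeasure_distr) (auto simp: borel_measurable_continuous_onI matrix_vector_mult_linear_continuous_on)
  also have "\<dots> = emeasure lebesgue ((*v) Q -` box l u)"
    using B by simp
  also have "\<dots> = ennreal (measure lebesgue ((*v) (transpose Q) ` box l u))"
    unfolding vim using measurable_orthogonal_image[OF T box]
    by (intro emeasure_eq_measure2)
  also have "\<dots> = ennreal (measure lebesgue (box l u))"
    using measure_orthogonal_image[OF T box] by simp
  also have "\<dots> = (\<Prod>b\<in>Basis. (u - l) \<bullet> b)"
    using le by (simp add: measure_lborel_box)
  finally show "emeasure (distr lborel borel ((*v) Q)) (box l u) = (\<Prod>b\<in>Basis. (u - l) \<bullet> b)" .
qed simp

text \<open>
  The centred normal density with independent coordinates depends on the norm only; this is the
  rotation invariance of the increments of the Wiener process.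
\<close>

lemma prod_normal_density:
  fixes x :: "real ^ 'n"
  shows "(\<Prod>i\<in>UNIV. normal_density 0 \<sigma> (x $ i))
    = (1 / sqrt (2 * pi * \<sigma>\<^sup>2)) ^ CARD('n) * exp (- (norm x)\<^sup>2 / (2 * \<sigma>\<^sup>2))"
proof -
  have "(\<Prod>i\<in>UNIV. normal_density 0 \<sigma> (x $ i))
      = (1 / sqrt (2 * pi * \<sigma>\<^sup>2)) ^ CARD('n) * exp (\<Sum>i\<in>UNIV. - (x $ i)\<^sup>2 / (2 * \<sigma>\<^sup>2))"
    by (simp add: normal_density_def prod.distrib exp_sum prod_dividef power_divide)
  also have "(\<Sum>i\<in>UNIV. - (x $ i)\<^sup>2 / (2 * \<sigma>\<^sup>2)) = - (norm x)\<^sup>2 / (2 * \<sigma>\<^sup>2)"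
    by (simp add: power2_norm_eq_inner inner_vec_def sum_negf sum_divide_distrib flip: power2_eq_square)
  finally show ?thesis .
qed

lemma wiener_process_measurable:
  "wiener_process M w \<Longrightarrow> t \<ge> 0 \<Longrightarrow> w t \<in> borel_measurable M"
  by (simp add: wiener_process_def)

lemma wiener_increment_law:
  assumes "prob_space M" and w: "wiener_process M w" and Q: "orthogonal_matrix Q"
    and "0 \<le> s" "s \<le> t" "0 \<le> \<tau>"
  shows "distr M borel (\<lambda>\<omega>. Q *v (w (t + \<tau>) \<omega> - w (s + \<tau>) \<omega>)) = distr M borel (\<lambda>\<omega>. w t \<omega> - w s \<omega>)"
proof (cases "s = t")
  case True
  then show ?thesis by simp
next
  case False
  interpret prob_space M by fact
  define \<rho> :: "real ^ 3 \<Rightarrow> ennreal" where "\<rho> x = (\<Prod>i\<in>UNIV. normal_density 0 (sqrt (t - s)) (x $ i))" for x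
  have [measurable]: "(*v) Q \<in> borel_measurable borel"
    by (rule borel_measurable_matrix_vector_mult)
  have inc: "distributed M lborel (\<lambda>\<omega>. w (t + r) \<omega> - w (s + r) \<omega>) \<rho>" if "0 \<le> r" for r
  proof -
    have "distributed M lborel (\<lambda>\<omega>. w (t + r) \<omega> - w (s + r) \<omega>)
        (\<lambda>x. ennreal (\<Prod>i\<in>UNIV. normal_density 0 (sqrt ((t + r) - (s + r))) (x $ i)))"
      using w \<open>0 \<le> s\<close> \<open>s \<le> t\<close> False that unfolding wiener_process_def
      by (elim conjE allE[of _ "s + r"] allE[of _ "t + r"]) auto
    then show ?thesis by (simp add: \<rho>_def[abs_def])
  qed
  have \<rho>Q: "\<rho> (Q *v x) = \<rho> x" for x
    by (simp add: \<rho>_def prod_normal_density norm_orthogonal_matrix[OF Q])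
  have \<rho> [measurable]: "\<rho> \<in> borel_measurable borel"
    using distributed_borel_measurable[OF inc[of 0]] by simp
  have m [measurable]: "(\<lambda>\<omega>. w (t + r) \<omega> - w (s + r) \<omega>) \<in> borel_measurable M" if "0 \<le> r" for r
    using distributed_measurable[OF inc[OF that]] by simp
  have "distr M borel (\<lambda>\<omega>. Q *v (w (t + \<tau>) \<omega> - w (s + \<tau>) \<omega>))
      = distr (distr M lborel (\<lambda>\<omega>. w (t + \<tau>) \<omega> - w (s + \<tau>) \<omega>)) borel ((*v) Q)"
    using m[OF \<open>0 \<le> \<tau>\<close>] by (subst distr_distr) (auto simp: comp_def)
  also have "\<dots> = distr (density lborel (\<lambda>x. \<rho> (Q *v x))) borel ((*v) Q)"
    using distributed_distr_eq_density[OF inc[OF \<open>0 \<le> \<tau>\<close>]] by (simp add: \<rho>Q)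
  also have "\<dots> = density (distr lborel borel ((*v) Q)) \<rho>"
    by (subst density_distr) auto
  also have "\<dots> = distr M lborel (\<lambda>\<omega>. w (t + 0) \<omega> - w (s + 0) \<omega>)"
    using distributed_distr_eq_density[OF inc[of 0]] by (simp add: distr_lborel_orthogonal_matrix[OF Q])
  also have "\<dots> = distr M borel (\<lambda>\<omega>. w t \<omega> - w s \<omega>)"
    by (intro distr_cong) auto
  finally show ?thesis .
qed

text \<open>
  Independence of increments is a statement about monotone sequences of times starting anywhere in
  \<open>[0, \<infinity>)\<close>. A finite set of times together with \<open>0\<close> is enumerated by its sorted list, which is
  continued by its last element.
\<close>

lemma finite_times_enumeration:
  fixes J :: "real set"
  assumes "finite J" "J \<subseteq> {0..}"
  obtains t :: "nat \<Rightarrow> real" and n k where "mono t" "t 0 = 0" "\<And>j. j \<in> J \<Longrightarrow> k j < Suc n \<and> t (k j) = j"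
proof -
  define xs where "xs = sorted_list_of_set (insert 0 J)"
  have xs: "sorted xs" "set xs = insert 0 J" using assms by (simp_all add: xs_def del: sorted_list_of_set_insert_remove)
  then have ne: "xs \<noteq> []" by auto
  define n where "n = length xs - 1"
  have n: "length xs = Suc n" using ne by (simp add: n_def)
  define t where "t i = xs ! min i n" for i
  have "mono t"
    using xs(1) n by (auto simp: mono_def t_def intro!: sorted_nth_mono)
  moreover have "t 0 = 0"
  proof -
    have "t 0 \<in> set xs" using n by (simp add: t_def)
    then have "t 0 \<ge> 0" using xs(2) assms by auto
    obtain i where "i < length xs" "xs ! i = 0" using xs(2) by (metis in_set_conv_nth insertI1)
    then have "t 0 \<le> 0" using sorted_nth_mono[OF xs(1), of 0 i] by (simp add: t_def)
    with \<open>t 0 \<ge> 0\<close> show ?thesis by simp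
  qed
  moreover have "\<exists>i. i < Suc n \<and> t i = j" if "j \<in> J" for j
  proof -
    have "j \<in> set xs" using that xs by simp
    then obtain i where "i < length xs" "xs ! i = j" by (metis in_set_conv_nth)
    then show ?thesis using n by (intro exI[of _ i]) (auto simp: t_def min_def)
  qed
  then obtain k where "\<And>j. j \<in> J \<Longrightarrow> k j < Suc n \<and> t (k j) = j" by metis
  ultimately show ?thesis using that by blast
qed

text \<open>
  Both sides are the same linear image of a family of independent increments over a common
  partition, and corresponding increments have the same law.
\<close>

lemma wiener_rotated_increments:
  assumes "prob_space M" and w: "wiener_process M w" and Q: "orthogonal_matrix Q"
    and J: "finite J" "J \<subseteq> {0..}" and \<tau>: "0 \<le> \<tau>"
  shows "distr M (\<Pi>\<^sub>M t\<in>J. borel) (\<lambda>\<omega>. \<lambda>t\<in>J. Q *v (w (t + \<tau>) \<omega> - w \<tau> \<omega>))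
       = distr M (\<Pi>\<^sub>M t\<in>J. borel) (\<lambda>\<omega>. \<lambda>t\<in>J. w t \<omega> - w 0 \<omega>)"
proof -
  interpret prob_space M by fact
  obtain t n k where t: "mono t" "t 0 = 0" and k: "\<And>j. j \<in> J \<Longrightarrow> k j < Suc n \<and> t (k j) = j"
    using finite_times_enumeration[OF J] by metis
  have t0: "0 \<le> t i" for i using t monoD[of t 0 i] by simp
  have [measurable]: "(*v) Q \<in> borel_measurable borel"
    by (rule borel_measurable_matrix_vector_mult)
  let ?I = "{..<Suc n}"
  let ?P = "\<Pi>\<^sub>M i\<in>?I. (borel :: (real ^ 3) measure)"
  define D where "D i \<omega> = w (t (Suc i)) \<omega> - w (t i) \<omega>" for i \<omega>
  define E where "E i \<omega> = Q *v (w (t (Suc i) + \<tau>) \<omega> - w (t i + \<tau>) \<omega>)" for i \<omega>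
  have indep: "indep_vars (\<lambda>_. borel) (\<lambda>k \<omega>. w (t (Suc k) + r) \<omega> - w (t k + r) \<omega>) ?I" if "0 \<le> r" for r
  proof -
    have "0 \<le> t 0 + r" "mono (\<lambda>i. t i + r)"
      using t that by (auto simp: mono_def)
    then show ?thesis
      using w unfolding wiener_process_def by (elim conjE allE[of _ "\<lambda>i. t i + r"]) auto
  qed
  have D: "indep_vars (\<lambda>_. borel) D ?I"
    using indep[of 0] by (simp add: D_def[abs_def])
  have E: "indep_vars (\<lambda>_. borel) E ?I"
    using indep_vars_compose2[OF indep[OF \<tau>], of "\<lambda>_. (*v) Q" "\<lambda>_. borel"] by (simp add: E_def[abs_def])
  have [measurable]: "D i \<in> borel_measurable M" "E i \<in> borel_measurable M" for i
    using t0 \<tau> unfolding D_def[abs_def] E_def[abs_def]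
    by (auto intro!: measurable_compose[OF _ \<open>(*v) Q \<in> borel_measurable borel\<close>] borel_measurable_diff
        wiener_process_measurable[OF w])
  have law: "distr M borel (E i) = distr M borel (D i)" for i
    unfolding D_def[abs_def] E_def[abs_def]
    using t0 monoD[OF t(1), of i "Suc i"] by (intro wiener_increment_law assms) auto
  have "distr M ?P (\<lambda>\<omega>. \<lambda>i\<in>?I. E i \<omega>) = (\<Pi>\<^sub>M i\<in>?I. distr M borel (E i))"
    using E by (subst (asm) indep_vars_iff_distr_eq_PiM') auto
  also have "\<dots> = distr M ?P (\<lambda>\<omega>. \<lambda>i\<in>?I. D i \<omega>)"
    using D by (subst (asm) indep_vars_iff_distr_eq_PiM') (auto simp: law)
  finally have PiM: "distr M ?P (\<lambda>\<omega>. \<lambda>i\<in>?I. E i \<omega>) = distr M ?P (\<lambda>\<omega>. \<lambda>i\<in>?I. D i \<omega>)" .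
  \<comment> \<open>The time \<open>j\<close> has number \<open>k j\<close>, so the increments before it add up to the increment from \<open>0\<close> to \<open>j\<close>.\<close>
  define F where "F y = (\<lambda>j\<in>J. \<Sum>i<k j. y i)" for y :: "nat \<Rightarrow> real ^ 3"
  have F [measurable]: "F \<in> ?P \<rightarrow>\<^sub>M (\<Pi>\<^sub>M t\<in>J. borel)"
    unfolding F_def[abs_def]
  proof (intro measurable_restrict borel_measurable_sum)
    fix j i assume "j \<in> J" "i \<in> {..<k j}"
    then show "(\<lambda>y. y i) \<in> borel_measurable ?P"
      using k[of j] by (intro measurable_component_singleton) auto
  qed
  have FD: "F (\<lambda>i\<in>?I. D i \<omega>) = (\<lambda>j\<in>J. w j \<omega> - w 0 \<omega>)" for \<omega>
    unfolding F_def
  proof (rule restrict_ext)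
    fix j assume "j \<in> J"
    then have "(\<Sum>i<k j. (\<lambda>i\<in>?I. D i \<omega>) i) = (\<Sum>i<k j. D i \<omega>)"
      using k[of j] by (intro sum.cong) auto
    also have "\<dots> = w (t (k j)) \<omega> - w (t 0) \<omega>" unfolding D_def by (rule sum_lessThan_telescope)
    finally show "(\<Sum>i<k j. (\<lambda>i\<in>?I. D i \<omega>) i) = w j \<omega> - w 0 \<omega>" using k[OF \<open>j \<in> J\<close>] t by simp
  qed
  have FE: "F (\<lambda>i\<in>?I. E i \<omega>) = (\<lambda>j\<in>J. Q *v (w (j + \<tau>) \<omega> - w \<tau> \<omega>))" for \<omega>
    unfolding F_def
  proof (rule restrict_ext)
    fix j assume "j \<in> J"
    then have "(\<Sum>i<k j. (\<lambda>i\<in>?I. E i \<omega>) i) = (\<Sum>i<k j. E i \<omega>)"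
      using k[of j] by (intro sum.cong) auto
    also have "\<dots> = Q *v (\<Sum>i<k j. w (t (Suc i) + \<tau>) \<omega> - w (t i + \<tau>) \<omega>)"
      unfolding E_def by (rule linear_sum[OF matrix_vector_mul_linear, symmetric])
    also have "\<dots> = Q *v (w (t (k j) + \<tau>) \<omega> - w (t 0 + \<tau>) \<omega>)"
      by (simp only: sum_lessThan_telescope[of "\<lambda>i. w (t i + \<tau>) \<omega>"])
    finally show "(\<Sum>i<k j. (\<lambda>i\<in>?I. E i \<omega>) i) = Q *v (w (j + \<tau>) \<omega> - w \<tau> \<omega>)" using k[OF \<open>j \<in> J\<close>] t by simp
  qed
  have "distr M (\<Pi>\<^sub>M t\<in>J. borel) (\<lambda>\<omega>. F (\<lambda>i\<in>?I. E i \<omega>)) = distr M (\<Pi>\<^sub>M t\<in>J. borel) (\<lambda>\<omega>. F (\<lambda>i\<in>?I. D i \<omega>))"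
  proof -
    have "distr M (\<Pi>\<^sub>M t\<in>J. borel) (\<lambda>\<omega>. F (\<lambda>i\<in>?I. Z i \<omega>)) = distr (distr M ?P (\<lambda>\<omega>. \<lambda>i\<in>?I. Z i \<omega>)) (\<Pi>\<^sub>M t\<in>J. borel) F"
      if "\<And>i. Z i \<in> borel_measurable M" for Z
      using that by (subst distr_distr[OF F]) (auto simp: comp_def intro!: measurable_restrict)
    then show ?thesis by (simp add: PiM)
  qed
  then show ?thesis unfolding FD FE .
qed

section \<open>The Gaussian field at fixed points\<close>

text \<open>
  Characteristic function of the field at the points \<open>a k\<close>, in the directions \<open>c k\<close>.
\<close>

definition xi_char :: "'k set \<Rightarrow> ('k \<Rightarrow> real ^ 3) \<Rightarrow> ('k \<Rightarrow> real ^ 3) \<Rightarrow> real" where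
  "xi_char K c a = exp (- (\<Sum>k\<in>K. \<Sum>l\<in>K. (c k \<bullet> c l) * exp (- (norm (a k - a l))\<^sup>2)) / 2)"

context prob_space
begin

lemma gaussian_rv_square_integrable:
  assumes "gaussian_rv M X"
  shows "integrable M X" "integrable M (\<lambda>\<omega>. (X \<omega>)\<^sup>2)"
proof -
  have [measurable]: "X \<in> borel_measurable M" using assms by (simp add: gaussian_rv_def)
  have "integrable M X \<and> integrable M (\<lambda>\<omega>. (X \<omega>)\<^sup>2)"
  proof (cases "\<exists>m. AE \<omega> in M. X \<omega> = m")
    case True
    then obtain m where m: "AE \<omega> in M. X \<omega> = m" by blast
    then have "AE \<omega> in M. norm (X \<omega>) \<le> \<bar>m\<bar>" "AE \<omega> in M. norm ((X \<omega>)\<^sup>2) \<le> m\<^sup>2" by auto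
    then show ?thesis by (auto intro!: integrable_const_bound)
  next
    case False
    then obtain m \<sigma> where \<sigma>: "0 < \<sigma>" and D: "distributed M lborel X (normal_density m \<sigma>)"
      using assms by (auto simp: gaussian_rv_def)
    have i: "integrable M (\<lambda>\<omega>. (X \<omega> - m) ^ k)" for k
      using integrable_normal_moment[OF \<sigma>, of m k]
        distributed_integrable[OF D, of "\<lambda>x. (x - m) ^ k"] by simp
    have 1: "X = (\<lambda>\<omega>. (X \<omega> - m) ^ 1 + m)"
      and 2: "(\<lambda>\<omega>. (X \<omega>)\<^sup>2) = (\<lambda>\<omega>. (X \<omega> - m)\<^sup>2 + 2 * m * (X \<omega> - m) ^ 1 + m\<^sup>2)"
      by (simp_all add: power2_eq_square algebra_simps)
    have "integrable M (\<lambda>\<omega>. (X \<omega> - m) ^ 1 + m)"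
      "integrable M (\<lambda>\<omega>. (X \<omega> - m)\<^sup>2 + 2 * m * (X \<omega> - m) ^ 1 + m\<^sup>2)"
      using i by (intro Bochner_Integration.integrable_add integrable_mult_right integrable_const; blast)+
    then show ?thesis using 1 2 by metis
  qed
  then show "integrable M X" "integrable M (\<lambda>\<omega>. (X \<omega>)\<^sup>2)" by auto
qed

text \<open>
  A constant variable has characteristic function \<open>1\<close> here, as its mean vanishes; this agrees with the
  formula for variance \<open>0\<close>.
\<close>

lemma gaussian_rv_iexp:
  assumes X: "gaussian_rv M X" and mean: "expectation X = 0"
  shows "(\<integral>\<omega>. iexp (X \<omega>) \<partial>M) = exp (- expectation (\<lambda>\<omega>. (X \<omega>)\<^sup>2) / 2)"
proof (cases "\<exists>m. AE \<omega> in M. X \<omega> = m")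
  case True
  have [measurable]: "X \<in> borel_measurable M" using assms by (simp add: gaussian_rv_def)
  obtain m where m: "AE \<omega> in M. X \<omega> = m" using True by blast
  have "expectation X = expectation (\<lambda>_. m)"
    using m by (intro integral_cong_AE) auto
  then have "m = 0" using mean by (simp add: prob_space)
  then have 0: "AE \<omega> in M. X \<omega> = 0" using m by simp
  have "(\<integral>\<omega>. iexp (X \<omega>) \<partial>M) = (\<integral>\<omega>. 1 \<partial>M)"
    using 0 by (intro integral_cong_AE) auto
  moreover have "expectation (\<lambda>\<omega>. (X \<omega>)\<^sup>2) = expectation (\<lambda>_. 0)"
    using 0 by (intro integral_cong_AE) auto
  ultimately show ?thesis by (simp add: prob_space)
next
  case False
  then obtain m \<sigma> where \<sigma>: "0 < \<sigma>" and D: "distributed M lborel X (normal_density m \<sigma>)"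
    using assms by (auto simp: gaussian_rv_def)
  have m: "m = 0" using normal_distributed_expectation[OF \<sigma> D] mean by simp
  have var: "expectation (\<lambda>\<omega>. (X \<omega>)\<^sup>2) = \<sigma>\<^sup>2"
    using normal_distributed_variance[OF \<sigma> D] mean by simp
  have Y: "distributed M lborel (\<lambda>\<omega>. X \<omega> / \<sigma>) std_normal_density"
    using normal_standard_normal_convert[OF \<sigma>, of X m] D by (simp add: m)
  have [measurable]: "X \<in> borel_measurable M" using assms by (simp add: gaussian_rv_def)
  have "(\<integral>\<omega>. iexp (X \<omega>) \<partial>M) = (\<integral>\<omega>. iexp (\<sigma> * (X \<omega> / \<sigma>)) \<partial>M)"
    using \<sigma> by simp
  also have "\<dots> = (\<integral>y. iexp (\<sigma> * y) \<partial>distr M lborel (\<lambda>\<omega>. X \<omega> / \<sigma>))"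
    by (subst integral_distr) (auto)
  also have "\<dots> = char std_normal_distribution \<sigma>"
    unfolding distributed_distr_eq_density[OF Y] char_def ..
  finally show ?thesis by (simp add: char_std_normal_distribution var)
qed

lemma gaussian_field_inner:
  assumes "gaussian_field M \<zeta>"
  shows "gaussian_rv M (\<lambda>\<omega>. b \<bullet> \<zeta> u \<omega>)"
proof -
  have "gaussian_rv M (\<lambda>\<omega>. \<Sum>v\<in>{u}. b \<bullet> \<zeta> v \<omega>)"
    using assms unfolding gaussian_field_def by (elim conjE allE[of _ "{u}"]) auto
  then show ?thesis by simp
qed

text \<open>
  The points \<open>a k\<close> may coincide, whereas the definition of a Gaussian field sums over a set of
  points: terms with the same point are collected.
\<close>

lemma gaussian_field_linear_combination:
  fixes \<zeta> :: "'i \<Rightarrow> 'a \<Rightarrow> 'b :: euclidean_space" and a :: "'k \<Rightarrow> 'i"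
  assumes \<zeta>: "gaussian_field M \<zeta>" and "finite K"
  shows "gaussian_rv M (\<lambda>\<omega>. \<Sum>k\<in>K. c k \<bullet> \<zeta> (a k) \<omega>)"
proof -
  have "(\<Sum>k\<in>K. c k \<bullet> \<zeta> (a k) \<omega>) = (\<Sum>u\<in>a ` K. (\<Sum>k\<in>{k\<in>K. a k = u}. c k) \<bullet> \<zeta> u \<omega>)" for \<omega>
    using \<open>finite K\<close> by (subst sum.image_gen[OF \<open>finite K\<close>, of _ a]) (auto simp: inner_sum_left intro!: sum.cong)
  then show ?thesis
    using \<zeta> \<open>finite K\<close> unfolding gaussian_field_def
    by (auto elim!: allE[of _ "a ` K"])
qed

lemma integrable_mult_if_square_integrable:
  fixes X Y :: "'a \<Rightarrow> real"
  assumes [measurable]: "X \<in> borel_measurable M" "Y \<in> borel_measurable M"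
    and "integrable M (\<lambda>\<omega>. (X \<omega>)\<^sup>2)" "integrable M (\<lambda>\<omega>. (Y \<omega>)\<^sup>2)"
  shows "integrable M (\<lambda>\<omega>. X \<omega> * Y \<omega>)"
proof (rule Bochner_Integration.integrable_bound)
  show "integrable M (\<lambda>\<omega>. (X \<omega>)\<^sup>2 + (Y \<omega>)\<^sup>2)" using assms by simp
  have "\<bar>x * y\<bar> \<le> x\<^sup>2 + y\<^sup>2" for x y :: real
  proof -
    have "2 * \<bar>x * y\<bar> \<le> x\<^sup>2 + y\<^sup>2"
      using sum_squares_bound[of "\<bar>x\<bar>" "\<bar>y\<bar>"] by (simp add: abs_mult mult.assoc)
    then show ?thesis using abs_ge_zero[of "x * y"] by linarith
  qed
  then show "AE \<omega> in M. norm (X \<omega> * Y \<omega>) \<le> norm ((X \<omega>)\<^sup>2 + (Y \<omega>)\<^sup>2)" by simp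
qed simp

context
  fixes \<xi> :: "real ^ 3 \<Rightarrow> 'a \<Rightarrow> real ^ 3"
  assumes \<xi>: "xi_field M \<xi>"
begin

lemma xi_gaussian: "gaussian_field M \<xi>"
  using \<xi> by (simp add: xi_field_def)

lemma xi_measurable [measurable]: "\<xi> u \<in> borel_measurable M"
  using xi_gaussian by (simp add: gaussian_field_def)

lemma xi_coordinate_gaussian: "gaussian_rv M (\<lambda>\<omega>. \<xi> u \<omega> $ i)"
  using gaussian_field_inner[OF xi_gaussian, of "axis i 1" u] by (simp add: inner_axis')

lemma xi_coordinate_measurable [measurable]: "(\<lambda>\<omega>. \<xi> u \<omega> $ i) \<in> borel_measurable M"
  using xi_coordinate_gaussian[of u i] by (simp add: gaussian_rv_def)

lemma xi_coordinate_mean: "expectation (\<lambda>\<omega>. \<xi> u \<omega> $ i) = 0"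
proof -
  have "integrable M (\<lambda>\<omega>. \<Sum>b\<in>Basis. (b \<bullet> \<xi> u \<omega>) *\<^sub>R b)"
    by (intro Bochner_Integration.integrable_sum integrable_scaleR_left
        gaussian_rv_square_integrable gaussian_field_inner xi_gaussian)
  then have i: "integrable M (\<xi> u)"
    by (simp add: inner_commute[of _ "\<xi> u _"] euclidean_representation)
  have "expectation (\<lambda>\<omega>. \<xi> u \<omega> \<bullet> axis i 1) = (\<integral>\<omega>. \<xi> u \<omega> \<partial>M) \<bullet> axis i 1"
    using i by (intro integral_inner_left)
  then show ?thesis
    using \<xi> by (simp add: inner_axis xi_field_def)
qed

lemma xi_coordinates_integrable: "integrable M (\<lambda>\<omega>. \<xi> u \<omega> $ i * \<xi> v \<omega> $ j)"
  by (intro integrable_mult_if_square_integrable gaussian_rv_square_integrable(2) xi_coordinate_gaussian) auto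

text \<open>
  Equal coordinates are compared with the first one through their common law; different
  coordinates are independent and centred.
\<close>

lemma xi_coordinates_covariance:
  "expectation (\<lambda>\<omega>. \<xi> u \<omega> $ i * \<xi> v \<omega> $ j) = (if i = j then exp (- (norm (u - v))\<^sup>2) else 0)"
proof (cases "i = j")
  case True
  let ?P = "\<Pi>\<^sub>M u\<in>UNIV. (borel :: real measure)"
  have m: "(\<lambda>\<omega> u. \<xi> u \<omega> $ k) \<in> M \<rightarrow>\<^sub>M ?P" for k
    by (rule measurable_PiM_single') auto
  have "expectation (\<lambda>\<omega>. \<xi> u \<omega> $ k * \<xi> v \<omega> $ k) = (\<integral>f. f u * f v \<partial>distr M ?P (\<lambda>\<omega> u. \<xi> u \<omega> $ k))" for k
    using m by (subst integral_distr) auto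
  moreover have "distr M ?P (\<lambda>\<omega> u. \<xi> u \<omega> $ i) = distr M ?P (\<lambda>\<omega> u. \<xi> u \<omega> $ 1)"
    using \<xi> unfolding xi_field_def by blast
  ultimately have "expectation (\<lambda>\<omega>. \<xi> u \<omega> $ i * \<xi> v \<omega> $ i) = expectation (\<lambda>\<omega>. \<xi> u \<omega> $ 1 * \<xi> v \<omega> $ 1)"
    by simp
  also have "\<dots> = exp (- (norm (u - v))\<^sup>2)" using \<xi> unfolding xi_field_def by blast
  finally show ?thesis using True by simp
next
  case False
  let ?p = "\<lambda>k. if k = i then u else v"
  have "indep_vars (\<lambda>_. \<Pi>\<^sub>M u\<in>UNIV. borel) (\<lambda>i \<omega> u. \<xi> u \<omega> $ i) UNIV"
    using \<xi> unfolding xi_field_def by blast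
  then have "indep_vars (\<lambda>_. \<Pi>\<^sub>M u\<in>UNIV. borel) (\<lambda>i \<omega> u. \<xi> u \<omega> $ i) {i, j}"
    by (rule indep_vars_subset) simp
  then have "indep_vars (\<lambda>_. borel) (\<lambda>k \<omega>. \<xi> (?p k) \<omega> $ k) {i, j}"
    by (rule indep_vars_compose2[where Y = "\<lambda>k f. f (?p k)"]) (simp add: measurable_component_singleton)
  then have "(\<integral>\<omega>. (\<Prod>k\<in>{i, j}. \<xi> (?p k) \<omega> $ k) \<partial>M) = (\<Prod>k\<in>{i, j}. expectation (\<lambda>\<omega>. \<xi> (?p k) \<omega> $ k))"
    by (intro indep_vars_lebesgue_integral gaussian_rv_square_integrable xi_coordinate_gaussian) auto
  then show ?thesis using False by (simp add: xi_coordinate_mean)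
qed

lemma xi_covariance:
  shows "integrable M (\<lambda>\<omega>. (b \<bullet> \<xi> u \<omega>) * (c \<bullet> \<xi> v \<omega>))"
    and "expectation (\<lambda>\<omega>. (b \<bullet> \<xi> u \<omega>) * (c \<bullet> \<xi> v \<omega>)) = (b \<bullet> c) * exp (- (norm (u - v))\<^sup>2)"
proof -
  have *: "(b \<bullet> \<xi> u \<omega>) * (c \<bullet> \<xi> v \<omega>) = (\<Sum>i\<in>UNIV. \<Sum>j\<in>UNIV. (b $ i * c $ j) * (\<xi> u \<omega> $ i * \<xi> v \<omega> $ j))" for \<omega>
    by (simp add: inner_vec_def sum_product algebra_simps)
  show "integrable M (\<lambda>\<omega>. (b \<bullet> \<xi> u \<omega>) * (c \<bullet> \<xi> v \<omega>))"
    unfolding * by (intro Bochner_Integration.integrable_sum integrable_mult_right xi_coordinates_integrable)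
  have "expectation (\<lambda>\<omega>. (b \<bullet> \<xi> u \<omega>) * (c \<bullet> \<xi> v \<omega>))
      = (\<Sum>i\<in>UNIV. \<Sum>j\<in>UNIV. (b $ i * c $ j) * (if i = j then exp (- (norm (u - v))\<^sup>2) else 0))"
    unfolding * by (simp add: xi_coordinates_integrable xi_coordinates_covariance)
  also have "\<dots> = (\<Sum>i\<in>UNIV. b $ i * c $ i * exp (- (norm (u - v))\<^sup>2))"
    by (simp add: if_distrib[of "(*) _"] cong: if_cong)
  also have "\<dots> = (b \<bullet> c) * exp (- (norm (u - v))\<^sup>2)"
    by (simp add: inner_vec_def sum_distrib_right)
  finally show "expectation (\<lambda>\<omega>. (b \<bullet> \<xi> u \<omega>) * (c \<bullet> \<xi> v \<omega>)) = (b \<bullet> c) * exp (- (norm (u - v))\<^sup>2)" .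
qed

lemma xi_iexp:
  assumes "finite K"
  shows "(\<integral>\<omega>. iexp (\<Sum>k\<in>K. c k \<bullet> \<xi> (a k) \<omega>) \<partial>M) = xi_char K c a"
proof -
  have i1: "integrable M (\<lambda>\<omega>. c k \<bullet> \<xi> (a k) \<omega>)" for k
    by (intro gaussian_rv_square_integrable gaussian_field_inner xi_gaussian)
  have m1: "expectation (\<lambda>\<omega>. c k \<bullet> \<xi> (a k) \<omega>) = 0" for k
    using gaussian_rv_square_integrable(1)[OF xi_coordinate_gaussian]
    by (simp add: inner_vec_def xi_coordinate_mean)
  have "expectation (\<lambda>\<omega>. \<Sum>k\<in>K. c k \<bullet> \<xi> (a k) \<omega>) = 0"
    by (simp add: i1 m1)
  moreover have "expectation (\<lambda>\<omega>. (\<Sum>k\<in>K. c k \<bullet> \<xi> (a k) \<omega>)\<^sup>2)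
      = (\<Sum>k\<in>K. \<Sum>l\<in>K. (c k \<bullet> c l) * exp (- (norm (a k - a l))\<^sup>2))"
    by (simp add: power2_eq_square sum_product xi_covariance)
  ultimately show ?thesis
    using gaussian_rv_iexp[OF gaussian_field_linear_combination[OF xi_gaussian assms, of c a]]
    by (simp add: xi_char_def)
qed

end

end

section \<open>The Gaussian field at independent random points\<close>

text \<open>
  The \<open>\<sigma>\<close>-algebras generated by the field and by the Wiener process, as measures on the sample space:
  independence is then inherited by everything measurable with respect to them.
\<close>

definition field_algebra :: "'w measure \<Rightarrow> (real ^ 3 \<Rightarrow> 'w \<Rightarrow> real ^ 3) \<Rightarrow> 'w measure" where
  "field_algebra M \<xi> = vimage_algebra (space M) (\<lambda>\<omega> u. \<xi> u \<omega>) (\<Pi>\<^sub>M u\<in>UNIV. borel)"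

definition process_algebra :: "'w measure \<Rightarrow> (real \<Rightarrow> 'w \<Rightarrow> real ^ 3) \<Rightarrow> 'w measure" where
  "process_algebra M w = vimage_algebra (space M) (\<lambda>\<omega>. \<lambda>t\<in>{0..}. w t \<omega>) (\<Pi>\<^sub>M t\<in>{0..}. borel)"

lemma space_field_algebra [simp]: "space (field_algebra M \<xi>) = space M"
  and space_process_algebra [simp]: "space (process_algebra M w) = space M"
  by (simp_all add: field_algebra_def process_algebra_def)

lemma field_algebra_measurable: "\<xi> u \<in> borel_measurable (field_algebra M \<xi>)"
proof -
  have "(\<lambda>\<omega> u. \<xi> u \<omega>) \<in> field_algebra M \<xi> \<rightarrow>\<^sub>M (\<Pi>\<^sub>M u\<in>UNIV. borel)"
    unfolding field_algebra_def by (rule measurable_vimage_algebra1) (simp add: space_PiM)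
  from measurable_compose[OF this measurable_component_singleton[of u]] show ?thesis by simp
qed

lemma process_algebra_measurable: "t \<ge> 0 \<Longrightarrow> w t \<in> borel_measurable (process_algebra M w)"
proof -
  assume t: "t \<ge> 0"
  have "(\<lambda>\<omega>. \<lambda>t\<in>{0..}. w t \<omega>) \<in> process_algebra M w \<rightarrow>\<^sub>M (\<Pi>\<^sub>M t\<in>{0..}. borel)"
    unfolding process_algebra_def by (rule measurable_vimage_algebra1) (auto simp: space_PiM)
  from measurable_compose[OF this measurable_component_singleton[of t]] show ?thesis using t by simp
qed

text \<open>
  The field need not be jointly measurable in the point and in \<open>\<omega>\<close>, but at a point with finitely
  many values its evaluation is a finite sum over these values.
\<close>

lemma xi_at_simple_point_measurable:
  fixes \<xi> :: "'u :: {second_countable_topology, metric_space} \<Rightarrow> 'w \<Rightarrow> 'b :: {second_countable_topology, real_normed_vector}"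
  assumes \<xi>: "\<And>u. \<xi> u \<in> borel_measurable M"
    and d: "simple_function borel d" and [measurable]: "z \<in> borel_measurable M"
  shows "(\<lambda>\<omega>. \<xi> (d (z \<omega>)) \<omega>) \<in> borel_measurable M"
proof -
  have fin: "finite (range d)" using d by (simp add: simple_function_def)
  note [measurable] = borel_measurable_simple_function[OF d] \<xi>
  have "(\<Sum>g\<in>range d. indicator {\<omega>\<in>space M. d (z \<omega>) = g} \<omega> *\<^sub>R \<xi> g \<omega>) = \<xi> (d (z \<omega>)) \<omega>"
    if "\<omega> \<in> space M" for \<omega>
  proof -
    have "(\<Sum>g\<in>range d. indicator {\<omega>\<in>space M. d (z \<omega>) = g} \<omega> *\<^sub>R \<xi> g \<omega>)
        = (\<Sum>g\<in>range d. if g = d (z \<omega>) then \<xi> g \<omega> else 0)"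
      using that by (intro sum.cong) (auto simp: indicator_def)
    then show ?thesis using fin by simp
  qed
  moreover have "(\<lambda>\<omega>. \<Sum>g\<in>range d. indicator {\<omega>\<in>space M. d (z \<omega>) = g} \<omega> *\<^sub>R \<xi> g \<omega>) \<in> borel_measurable M"
    by measurable
  ultimately show ?thesis by (subst (asm) measurable_cong) auto
qed

lemma simple_functions_tendsto_id:
  obtains d :: "nat \<Rightarrow> real ^ 3 \<Rightarrow> real ^ 3"
  where "\<And>n. simple_function borel (d n)" "\<And>x. (\<lambda>n. d n x) \<longlonglongrightarrow> x"
  using borel_measurable_implies_sequence_metric[of "\<lambda>x :: real ^ 3. x" borel 0] by auto

context prob_space
begin

context
  fixes \<xi> :: "real ^ 3 \<Rightarrow> 'a \<Rightarrow> real ^ 3" and w :: "real \<Rightarrow> 'a \<Rightarrow> real ^ 3"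
  assumes indep: "indep_field_process M \<xi> w"
begin

lemma field_algebra_sub: "sets (field_algebra M \<xi>) \<subseteq> events"
  and process_algebra_sub: "sets (process_algebra M w) \<subseteq> events"
  using indep unfolding indep_field_process_def field_algebra_def process_algebra_def
  by (auto simp: indep_sets2_eq)

lemma process_algebra_measurableD: "f \<in> process_algebra M w \<rightarrow>\<^sub>M N \<Longrightarrow> f \<in> M \<rightarrow>\<^sub>M N"
  and field_algebra_measurableD: "f \<in> field_algebra M \<xi> \<rightarrow>\<^sub>M N \<Longrightarrow> f \<in> M \<rightarrow>\<^sub>M N"
  using field_algebra_sub process_algebra_sub by (auto simp: measurable_def)

lemma indep_var_field_process:
  assumes F: "F \<in> field_algebra M \<xi> \<rightarrow>\<^sub>M S" and G: "G \<in> process_algebra M w \<rightarrow>\<^sub>M T"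
  shows "indep_var S F T G"
proof -
  have "indep_set (sets (field_algebra M \<xi>)) (sets (process_algebra M w))"
    using indep by (simp add: indep_field_process_def field_algebra_def process_algebra_def)
  moreover have "sigma_sets (space M) {F -` A \<inter> space M |A. A \<in> sets S} \<subseteq> sets (field_algebra M \<xi>)"
    using measurable_sets[OF F] sets.sigma_sets_subset[of "{F -` A \<inter> space M |A. A \<in> sets S}" "field_algebra M \<xi>"]
    by fastforce
  moreover have "sigma_sets (space M) {G -` A \<inter> space M |A. A \<in> sets T} \<subseteq> sets (process_algebra M w)"
    using measurable_sets[OF G] sets.sigma_sets_subset[of "{G -` A \<inter> space M |A. A \<in> sets T}" "process_algebra M w"]
    by fastforce
  ultimately show ?thesis
    using F G unfolding indep_var_eq indep_set_def
    by (auto intro: process_algebra_measurableD field_algebra_measurableD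
        elim!: indep_sets_mono_sets split: bool.splits)
qed

text \<open>
  When the random points take finitely many values, the expectation is a finite sum over their joint
  values. On each event that fixes the values, independence factors the expectation, and
  the characteristic function at fixed points is known.
\<close>

lemma xi_iexp_random_simple:
  assumes \<xi>: "xi_field M \<xi>" and K: "finite K"
    and d: "simple_function borel d"
    and z: "\<And>k. k \<in> K \<Longrightarrow> z k \<in> borel_measurable (process_algebra M w)"
  shows "(\<integral>\<omega>. iexp (\<Sum>k\<in>K. c k \<bullet> \<xi> (d (z k \<omega>)) \<omega>) \<partial>M) = complex_of_real (\<integral>\<omega>. xi_char K c (\<lambda>k. d (z k \<omega>)) \<partial>M)"
proof -
  \<comment> \<open>All joint values of the points, and the events \<open>C g\<close> on which they are attained.\<close>
  define G where "G = (\<Pi>\<^sub>E k\<in>K. range d)"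
  have fG: "finite G"
    using d K unfolding G_def simple_function_def by (intro finite_PiE) auto
  have dm: "d \<in> borel_measurable borel" using d by (rule borel_measurable_simple_function)
  define C where "C g = {\<omega>\<in>space M. \<forall>k\<in>K. d (z k \<omega>) = g k}" for g
  have C: "C g \<in> sets (process_algebra M w)" for g
  proof -
    have [measurable]: "(\<lambda>\<omega>. d (z k \<omega>)) \<in> borel_measurable (process_algebra M w)" if "k \<in> K" for k
      using measurable_compose[OF z[OF that] dm] .
    have "{\<omega>\<in>space (process_algebra M w). \<forall>k\<in>K. d (z k \<omega>) = g k} \<in> sets (process_algebra M w)"
      using K by measurable
    then show ?thesis by (simp add: C_def)
  qed
  have CM [measurable]: "C g \<in> events" for g using C process_algebra_sub by blast
  have split: "(\<Sum>g\<in>G. indicator (C g) \<omega> * h g) = h (\<lambda>k\<in>K. d (z k \<omega>))"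
    if "\<omega> \<in> space M" for \<omega> and h :: "_ \<Rightarrow> complex"
  proof -
    let ?g = "\<lambda>k\<in>K. d (z k \<omega>)"
    have "?g \<in> G" by (auto simp: G_def)
    moreover have "indicator (C g) \<omega> * h g = (if g = ?g then h g else 0)" if "g \<in> G" for g
    proof -
      have "\<omega> \<in> C g \<longleftrightarrow> g = ?g"
        using that \<open>\<omega> \<in> space M\<close> by (auto simp: C_def G_def PiE_iff extensional_def fun_eq_iff)
      then show ?thesis by (simp add: indicator_def)
    qed
    ultimately show ?thesis using fG by (simp add: sum.delta')
  qed
  define H where "H g \<omega> = iexp (\<Sum>k\<in>K. c k \<bullet> \<xi> (g k) \<omega>)" for g \<omega>
  note field_algebra_measurable [measurable]
  have Hf: "H g \<in> borel_measurable (field_algebra M \<xi>)" for g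
    unfolding H_def[abs_def] by measurable
  have HM [measurable]: "H g \<in> borel_measurable M" for g
    using Hf by (rule field_algebra_measurableD)
  have Hi: "integrable M (H g)" for g
    by (intro integrable_const_bound[where B = 1]) (auto simp: H_def)
  have prod: "(\<integral>\<omega>. indicator (C g) \<omega> * H g \<omega> \<partial>M) = (\<integral>\<omega>. indicator (C g) \<omega> * complex_of_real (xi_char K c g) \<partial>M)"
    and ip: "integrable M (\<lambda>\<omega>. indicator (C g) \<omega> * H g \<omega>)" for g
  proof -
    have "indep_var borel (H g) borel (indicator (C g) :: 'a \<Rightarrow> complex)"
      using C[of g] by (intro indep_var_field_process Hf) simp
    moreover have "integrable M (indicator (C g) :: 'a \<Rightarrow> complex)"
      by (intro integrable_const_bound[where B = 1]) (auto simp: indicator_def)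
    ultimately have "(\<integral>\<omega>. H g \<omega> * indicator (C g) \<omega> \<partial>M) = (\<integral>\<omega>. H g \<omega> \<partial>M) * (\<integral>\<omega>. indicator (C g) \<omega> \<partial>M)"
      and "integrable M (\<lambda>\<omega>. H g \<omega> * indicator (C g) \<omega>)"
      using Hi by (simp_all add: indep_var_lebesgue_integral indep_var_integrable)
    moreover have "(\<integral>\<omega>. H g \<omega> \<partial>M) = xi_char K c g"
      unfolding H_def by (rule xi_iexp[OF \<xi> K])
    ultimately show "(\<integral>\<omega>. indicator (C g) \<omega> * H g \<omega> \<partial>M) = (\<integral>\<omega>. indicator (C g) \<omega> * complex_of_real (xi_char K c g) \<partial>M)"
      and "integrable M (\<lambda>\<omega>. indicator (C g) \<omega> * H g \<omega>)"
      by (simp_all add: mult.commute)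
  qed
  have "(\<integral>\<omega>. iexp (\<Sum>k\<in>K. c k \<bullet> \<xi> (d (z k \<omega>)) \<omega>) \<partial>M) = (\<integral>\<omega>. (\<Sum>g\<in>G. indicator (C g) \<omega> * H g \<omega>) \<partial>M)"
    by (intro Bochner_Integration.integral_cong refl, subst split) (simp_all add: H_def cong: sum.cong)
  also have "\<dots> = (\<Sum>g\<in>G. (\<integral>\<omega>. indicator (C g) \<omega> * complex_of_real (xi_char K c g) \<partial>M))"
    using ip by (simp add: Bochner_Integration.integral_sum prod)
  also have "\<dots> = (\<integral>\<omega>. (\<Sum>g\<in>G. indicator (C g) \<omega> * complex_of_real (xi_char K c g)) \<partial>M)"
    by (intro Bochner_Integration.integral_sum[symmetric] integrable_const_bound[where B = "norm (xi_char K c _)"])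
      (auto simp: indicator_def)
  also have "\<dots> = (\<integral>\<omega>. complex_of_real (xi_char K c (\<lambda>k. d (z k \<omega>))) \<partial>M)"
    by (intro Bochner_Integration.integral_cong refl, subst split) (simp_all add: xi_char_def cong: sum.cong)
  finally show ?thesis by simp
qed

text \<open>
  Random points are approximated by points with finitely many values. The paths of \<open>\<xi>\<close> are
  almost surely continuous and \<open>xi_char\<close> is continuous, so both sides converge boundedly.
  The variables \<open>Z k\<close> stand for the field at the random points, because off the event of
  continuous paths that evaluation need not be measurable.
\<close>

lemma xi_iexp_random:
  assumes \<xi>: "xi_field M \<xi>" and K: "finite K"
    and z: "\<And>k. k \<in> K \<Longrightarrow> z k \<in> borel_measurable (process_algebra M w)"
    and Z [measurable]: "\<And>k. k \<in> K \<Longrightarrow> Z k \<in> borel_measurable M"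
    and Zz: "\<And>k. k \<in> K \<Longrightarrow> AE \<omega> in M. Z k \<omega> = \<xi> (z k \<omega>) \<omega>"
    and cont: "AE \<omega> in M. continuous_on UNIV (\<lambda>u. \<xi> u \<omega>)"
  shows "(\<integral>\<omega>. iexp (\<Sum>k\<in>K. c k \<bullet> Z k \<omega>) \<partial>M) = complex_of_real (\<integral>\<omega>. xi_char K c (\<lambda>k. z k \<omega>) \<partial>M)"
proof -
  obtain d :: "nat \<Rightarrow> real ^ 3 \<Rightarrow> real ^ 3"
    where d: "\<And>n. simple_function borel (d n)" "\<And>x. (\<lambda>n. d n x) \<longlonglongrightarrow> x"
    using simple_functions_tendsto_id by blast
  have zM [measurable]: "z k \<in> borel_measurable M" if "k \<in> K" for k
    using z[OF that] by (rule process_algebra_measurableD)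
  note [measurable] = borel_measurable_simple_function[OF d(1)]
  \<comment> \<open>A characteristic function is bounded by \<open>1\<close>; the double sum itself shows no sign.\<close>
  have char_le: "norm (xi_char K c a) \<le> 1" for a :: "_ \<Rightarrow> real ^ 3"
  proof -
    have "norm (complex_of_real (xi_char K c a)) \<le> (\<integral>\<omega>. norm (iexp (\<Sum>k\<in>K. c k \<bullet> \<xi> (a k) \<omega>)) \<partial>M)"
      unfolding xi_iexp[OF \<xi> K, symmetric] by (rule integral_norm_bound)
    then show ?thesis by (simp add: prob_space)
  qed
  have "(\<lambda>n. \<integral>\<omega>. iexp (\<Sum>k\<in>K. c k \<bullet> \<xi> (d n (z k \<omega>)) \<omega>) \<partial>M) \<longlonglongrightarrow> (\<integral>\<omega>. iexp (\<Sum>k\<in>K. c k \<bullet> Z k \<omega>) \<partial>M)"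
  proof (rule integral_dominated_convergence[where w = "\<lambda>_. 1"])
    have "AE \<omega> in M. \<forall>k\<in>K. Z k \<omega> = \<xi> (z k \<omega>) \<omega>"
      using K Zz by (rule AE_finite_allI)
    with cont show "AE \<omega> in M. (\<lambda>n. iexp (\<Sum>k\<in>K. c k \<bullet> \<xi> (d n (z k \<omega>)) \<omega>)) \<longlonglongrightarrow> iexp (\<Sum>k\<in>K. c k \<bullet> Z k \<omega>)"
    proof eventually_elim
      case (elim \<omega>)
      have "(\<lambda>n. \<xi> (d n (z k \<omega>)) \<omega>) \<longlonglongrightarrow> Z k \<omega>" if "k \<in> K" for k
      proof -
        have "(\<lambda>n. \<xi> (d n (z k \<omega>)) \<omega>) \<longlonglongrightarrow> \<xi> (z k \<omega>) \<omega>"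
          by (rule continuous_on_tendsto_compose[OF elim(1) d(2)]) auto
        then show ?thesis using elim(2) that by metis
      qed
      then show ?case
        by (intro tendsto_exp tendsto_mult tendsto_const tendsto_of_real tendsto_sum tendsto_inner)
    qed
    have [measurable]: "(\<lambda>\<omega>. \<xi> (d n (z k \<omega>)) \<omega>) \<in> borel_measurable M" if "k \<in> K" for n k
      by (rule xi_at_simple_point_measurable[OF xi_measurable[OF \<xi>] d(1) zM[OF that]])
    show "(\<lambda>\<omega>. iexp (\<Sum>k\<in>K. c k \<bullet> \<xi> (d n (z k \<omega>)) \<omega>)) \<in> borel_measurable M" for n
      by measurable
  qed auto
  moreover have "(\<lambda>n. complex_of_real (\<integral>\<omega>. xi_char K c (\<lambda>k. d n (z k \<omega>)) \<partial>M))
      \<longlonglongrightarrow> complex_of_real (\<integral>\<omega>. xi_char K c (\<lambda>k. z k \<omega>) \<partial>M)"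
  proof (intro tendsto_of_real integral_dominated_convergence[where w = "\<lambda>_. 1"])
    show "AE \<omega> in M. (\<lambda>n. xi_char K c (\<lambda>k. d n (z k \<omega>))) \<longlonglongrightarrow> xi_char K c (\<lambda>k. z k \<omega>)"
      unfolding xi_char_def
      by (intro AE_I2 tendsto_exp tendsto_divide tendsto_minus tendsto_mult tendsto_const tendsto_sum
          tendsto_power tendsto_norm tendsto_diff d) simp
  qed (use char_le in \<open>auto simp: xi_char_def\<close>)
  moreover have "(\<integral>\<omega>. iexp (\<Sum>k\<in>K. c k \<bullet> \<xi> (d n (z k \<omega>)) \<omega>) \<partial>M)
      = complex_of_real (\<integral>\<omega>. xi_char K c (\<lambda>k. d n (z k \<omega>)) \<partial>M)" for n
    by (rule xi_iexp_random_simple[OF \<xi> K d(1) z])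
  ultimately show ?thesis using LIMSEQ_unique by fastforce
qed

end
end

section \<open>Borel sets of the space of periodic curves\<close>

text \<open>
  For continuous curves a dense set of parameters suffices; a countable one gives measurability of
  the supremum.
\<close>

lemma sup_dist_le_iff:
  assumes f: "continuous_on UNIV f" and g: "continuous_on UNIV g" and T: "T \<subseteq> {0..2 * pi}" "{0..2 * pi} \<subseteq> closure T"
  shows "sup_dist f g \<le> a \<longleftrightarrow> (\<forall>s\<in>T. dist (f s) (g s) \<le> a)"
proof
  assume "sup_dist f g \<le> a"
  then show "\<forall>s\<in>T. dist (f s) (g s) \<le> a"
    using sup_dist_upper[OF f g] T(1) by (meson order_trans subsetD)
next
  assume le: "\<forall>s\<in>T. dist (f s) (g s) \<le> a"
  have "closed {s. dist (f s) (g s) \<le> a}"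
    by (intro closed_Collect_le continuous_intros f g)
  then have "closure T \<subseteq> {s. dist (f s) (g s) \<le> a}"
    using le by (intro closure_minimal) auto
  then have "dist (f s) (g s) \<le> a" if "s \<in> {0..2 * pi}" for s using that T(2) by auto
  then show "sup_dist f g \<le> a"
    unfolding sup_dist_def by (intro cSUP_least) auto
qed

lemma sup_dist_measurable:
  assumes f: "continuous_on UNIV f" and h: "\<And>\<omega>. \<omega> \<in> space N \<Longrightarrow> continuous_on UNIV (h \<omega>)"
    and [measurable]: "\<And>s. (\<lambda>\<omega>. h \<omega> s) \<in> borel_measurable N"
  shows "(\<lambda>\<omega>. sup_dist f (h \<omega>)) \<in> borel_measurable N"
proof -
  obtain T where T: "countable T" "T \<subseteq> {0..2 * pi}" "{0..2 * pi} \<subseteq> closure T"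
    by (rule separable[of "{0..2 * pi}"])
  have "{\<omega>\<in>space N. sup_dist f (h \<omega>) \<le> a} \<in> sets N" for a
  proof -
    have "{\<omega>\<in>space N. sup_dist f (h \<omega>) \<le> a} = {\<omega>\<in>space N. \<forall>s\<in>T. dist (f s) (h \<omega> s) \<le> a}"
      using sup_dist_le_iff[OF f h T(2,3)] by auto
    also have "\<dots> \<in> sets N" using T(1) by measurable
    finally show ?thesis .
  qed
  then show ?thesis by (simp add: borel_measurable_iff_le)
qed

text \<open>
  A derivative is a limit of difference quotients along a sequence.
\<close>

lemma vderiv_measurable:
  assumes h: "\<And>\<omega> s. \<omega> \<in> space N \<Longrightarrow> (h \<omega> has_vector_derivative vderiv (h \<omega>) s) (at s)"
    and [measurable]: "\<And>s. (\<lambda>\<omega>. h \<omega> s) \<in> borel_measurable N"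
  shows "(\<lambda>\<omega>. vderiv (h \<omega>) s) \<in> borel_measurable N"
proof (rule borel_measurable_LIMSEQ_metric)
  let ?e = "\<lambda>n. inverse (real (Suc n))"
  fix \<omega> assume "\<omega> \<in> space N"
  then have "((\<lambda>e. norm (h \<omega> (s + e) - h \<omega> s - e *\<^sub>R vderiv (h \<omega>) s) / norm e) \<longlongrightarrow> 0) (at 0)"
    using h[of \<omega> s] by (simp add: has_vector_derivative_def has_derivative_at)
  then have "((\<lambda>e. norm ((h \<omega> (s + e) - h \<omega> s) /\<^sub>R e - vderiv (h \<omega>) s)) \<longlongrightarrow> 0) (at 0)"
  proof (rule Lim_transform_eventually)
    have "norm (x - e *\<^sub>R v) / norm e = norm (x /\<^sub>R e - v)" if "e \<noteq> 0" for x v :: "real ^ 3" and e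
    proof -
      have "x /\<^sub>R e - v = (x - e *\<^sub>R v) /\<^sub>R e" using that by (simp add: scaleR_diff_right)
      then show ?thesis by (simp add: divide_inverse mult.commute)
    qed
    then show "\<forall>\<^sub>F e in at 0. norm (h \<omega> (s + e) - h \<omega> s - e *\<^sub>R vderiv (h \<omega>) s) / norm e
        = norm ((h \<omega> (s + e) - h \<omega> s) /\<^sub>R e - vderiv (h \<omega>) s)"
      by (intro eventually_at_topological[THEN iffD2] exI[of _ UNIV]) auto
  qed
  then have "((\<lambda>e. (h \<omega> (s + e) - h \<omega> s) /\<^sub>R e) \<longlongrightarrow> vderiv (h \<omega>) s) (at 0)"
    by (rule LIM_zero_cancel[OF tendsto_norm_zero_cancel])
  moreover have "filterlim ?e (at 0) sequentially"
    unfolding filterlim_at using LIMSEQ_inverse_real_of_nat by auto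
  ultimately show "(\<lambda>n. (h \<omega> (s + ?e n) - h \<omega> s) /\<^sub>R ?e n) \<longlonglongrightarrow> vderiv (h \<omega>) s"
    by (rule filterlim_compose)
qed measurable

lemma C2_dist_measurable:
  assumes f: "f \<in> C2p" and h: "\<And>\<omega>. \<omega> \<in> space N \<Longrightarrow> h \<omega> \<in> C2p"
    and m: "\<And>s. (\<lambda>\<omega>. h \<omega> s) \<in> borel_measurable N"
  shows "(\<lambda>\<omega>. C2_dist f (h \<omega>)) \<in> borel_measurable N"
proof -
  have m1: "(\<lambda>\<omega>. vderiv (h \<omega>) s) \<in> borel_measurable N" for s
    using h by (intro vderiv_measurable m C2p_derivs(1))
  have m2: "(\<lambda>\<omega>. vderiv (vderiv (h \<omega>)) s) \<in> borel_measurable N" for s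
    using h by (intro vderiv_measurable m1 C2p_derivs(2))
  have "(\<lambda>\<omega>. sup_dist f (h \<omega>) + sup_dist (vderiv f) (vderiv (h \<omega>))
      + sup_dist (vderiv (vderiv f)) (vderiv (vderiv (h \<omega>)))) \<in> borel_measurable N"
    using h by (intro borel_measurable_add sup_dist_measurable m m1 m2 C2p_derivs f)
  then show ?thesis
    using f h by (subst measurable_cong[where g = "\<lambda>\<omega>. sup_dist f (h \<omega>) + sup_dist (vderiv f) (vderiv (h \<omega>))
      + sup_dist (vderiv (vderiv f)) (vderiv (vderiv (h \<omega>)))"]) (auto simp: C2_dist_def)
qed

text \<open>
  Separability of the uniform distance, in a form that transfers to subspaces without further work. A
  curve is coded by a mesh on which it oscillates little and by approximations of its values
  on this mesh from a countable dense set. Equal codes force uniform closeness, and the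
  codes form a countable type.
\<close>

lemma continuous_curve_code:
  assumes "\<epsilon> > 0"
  shows "\<exists>code :: (real \<Rightarrow> real ^ 3) \<Rightarrow> nat \<times> nat list.
    \<forall>f g. continuous_on UNIV f \<longrightarrow> continuous_on UNIV g \<longrightarrow> code f = code g \<longrightarrow> sup_dist f g \<le> \<epsilon>"
proof -
  obtain D :: "(real ^ 3) set" where D: "countable D" "\<And>X. open X \<Longrightarrow> X \<noteq> {} \<Longrightarrow> \<exists>d\<in>D. d \<in> X"
    using countable_dense_exists by blast
  have "\<exists>i. dist (from_nat_into D i) y < \<epsilon> / 4" for y
  proof -
    obtain d where "d \<in> D" "d \<in> ball y (\<epsilon> / 4)" using D(2)[of "ball y (\<epsilon> / 4)"] assms by auto
    then show ?thesis
      using D(1) by (intro exI[of _ "to_nat_on D d"]) (simp add: dist_commute)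
  qed
  then obtain r where r: "\<And>y. dist (from_nat_into D (r y)) y < \<epsilon> / 4" by metis
  let ?fine = "\<lambda>f n. 0 < n \<and> (\<forall>s\<in>{0..2 * pi}. \<forall>s'\<in>{0..2 * pi}. \<bar>s - s'\<bar> \<le> 2 * pi / real n \<longrightarrow> dist (f s) (f s') \<le> \<epsilon> / 4)"
  have "\<exists>n. ?fine f n" if "continuous_on UNIV f" for f :: "real \<Rightarrow> real ^ 3"
  proof -
    have "uniformly_continuous_on {0..2 * pi} f"
      using that by (intro compact_uniformly_continuous) (auto intro: continuous_on_subset)
    then obtain \<delta> where \<delta>: "\<delta> > 0" "\<And>s s'. s \<in> {0..2 * pi} \<Longrightarrow> s' \<in> {0..2 * pi} \<Longrightarrow> dist s' s < \<delta> \<Longrightarrow> dist (f s') (f s) < \<epsilon> / 4"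
      using assms unfolding uniformly_continuous_on_def by (metis divide_pos_pos zero_less_numeral)
    obtain n where n: "2 * pi / \<delta> < real n" using reals_Archimedean2 by blast
    have "0 < 2 * pi / \<delta>" using \<delta>(1) by simp
    then have "0 < real n" using n by linarith
    moreover have "2 * pi / real n < \<delta>" using n \<delta>(1) \<open>0 < real n\<close> by (simp add: field_simps)
    ultimately show ?thesis
      using \<delta>(2) by (intro exI[of _ n]) (force simp: dist_real_def intro: less_imp_le)
  qed
  then obtain n where n: "\<And>f :: real \<Rightarrow> real ^ 3. continuous_on UNIV f \<Longrightarrow> ?fine f (n f)" by metis
  define code where "code f = (n f, map (\<lambda>k. r (f (2 * pi * real k / real (n f)))) [0..<Suc (n f)])" for f
  have "sup_dist f g \<le> \<epsilon>" if f: "continuous_on UNIV f" and g: "continuous_on UNIV g" and eq: "code f = code g" for f g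
  proof -
    define m where "m = n f"
    have m: "n g = m" "n f = m" using eq by (auto simp: code_def m_def)
    have fine: "?fine f m" "?fine g m" using n[OF f] n[OF g] m by auto
    have rk: "r (f (2 * pi * real k / real m)) = r (g (2 * pi * real k / real m))" if "k \<le> m" for k
      using eq that m by (auto simp: code_def simp del: upt_Suc)
    have "dist (f s) (g s) \<le> \<epsilon>" if s: "s \<in> {0..2 * pi}" for s
    proof -
      have m0: "0 < real m" using fine(1) by simp
      \<comment> \<open>The mesh point \<open>p\<close> to the left of \<open>s\<close>; the distance from \<open>f s\<close> to \<open>g s\<close> is bounded through
        \<open>f p\<close>, the common approximation and \<open>g p\<close>.\<close>
      define k where "k = nat \<lfloor>s * real m / (2 * pi)\<rfloor>"
      define p where "p = 2 * pi * real k / real m"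
      have "0 \<le> s * real m / (2 * pi)" using s m0 by simp
      then have k: "real k \<le> s * real m / (2 * pi)" "s * real m / (2 * pi) < real k + 1"
        unfolding k_def by linarith+
      have p: "p \<le> s" "s < p + 2 * pi / real m" "0 \<le> p"
        using k m0 by (simp_all add: p_def field_simps)
      have "s * real m / (2 * pi) \<le> real m" using s m0 by (simp add: field_simps)
      then have "k \<le> m" using k(1) by linarith
      have "p \<in> {0..2 * pi}" "\<bar>s - p\<bar> \<le> 2 * pi / real m" using p s by auto
      then have 1: "dist (f s) (f p) \<le> \<epsilon> / 4" "dist (g s) (g p) \<le> \<epsilon> / 4" using fine s by blast+
      have 2: "dist (from_nat_into D (r (f p))) (f p) < \<epsilon> / 4" "dist (from_nat_into D (r (f p))) (g p) < \<epsilon> / 4"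
        using r[of "f p"] r[of "g p"] rk[OF \<open>k \<le> m\<close>] by (simp_all add: p_def)
      show ?thesis
        using 1 2 dist_triangle[of "f s" "g s" "f p"] dist_triangle[of "f p" "g s" "g p"]
          dist_triangle2[of "f p" "g p" "from_nat_into D (r (f p))"]
        by (simp add: dist_commute)
    qed
    then show ?thesis unfolding sup_dist_def by (intro cSUP_least) auto
  qed
  then show ?thesis by blast
qed

text \<open>
  The codes of a curve and of its first two derivatives divide the space, for each \<open>\<epsilon>\<close>, into countably
  many classes of diameter less than \<open>\<epsilon>\<close>. Choosing one curve from each nonempty class keeps the dense set
  inside the space.
\<close>

lemma C2p_separable:
  obtains D where "countable D" "D \<subseteq> C2p" "\<And>f \<epsilon>. f \<in> C2p \<Longrightarrow> 0 < \<epsilon> \<Longrightarrow> \<exists>g\<in>D. C2_dist g f < \<epsilon>"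
proof -
  have "\<exists>c :: (real \<Rightarrow> real ^ 3) \<Rightarrow> (nat \<times> nat list) \<times> (nat \<times> nat list) \<times> (nat \<times> nat list).
      \<forall>f\<in>C2p. \<forall>g\<in>C2p. c f = c g \<longrightarrow> C2_dist f g < \<epsilon>" if "0 < \<epsilon>" for \<epsilon>
  proof -
    have "0 < \<epsilon> / 4" using that by simp
    then obtain code :: "(real \<Rightarrow> real ^ 3) \<Rightarrow> nat \<times> nat list"
      where code: "\<And>f g. continuous_on UNIV f \<Longrightarrow> continuous_on UNIV g \<Longrightarrow> code f = code g \<Longrightarrow> sup_dist f g \<le> \<epsilon> / 4"
      using continuous_curve_code by blast
    have "C2_dist f g < \<epsilon>"
      if "f \<in> C2p" "g \<in> C2p" "code f = code g" "code (vderiv f) = code (vderiv g)"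
        "code (vderiv (vderiv f)) = code (vderiv (vderiv g))" for f g
    proof -
      have "sup_dist f g \<le> \<epsilon> / 4" "sup_dist (vderiv f) (vderiv g) \<le> \<epsilon> / 4"
        "sup_dist (vderiv (vderiv f)) (vderiv (vderiv g)) \<le> \<epsilon> / 4"
        using that by (simp_all only: code C2p_derivs)
      then show ?thesis using that \<open>0 < \<epsilon>\<close> by (simp add: C2_dist_def)
    qed
    then show ?thesis
      by (intro exI[of _ "\<lambda>f. (code f, code (vderiv f), code (vderiv (vderiv f)))"]) auto
  qed
  then obtain c :: "real \<Rightarrow> (real \<Rightarrow> real ^ 3) \<Rightarrow> (nat \<times> nat list) \<times> (nat \<times> nat list) \<times> (nat \<times> nat list)"
    where c: "\<And>\<epsilon> f g. 0 < \<epsilon> \<Longrightarrow> f \<in> C2p \<Longrightarrow> g \<in> C2p \<Longrightarrow> c \<epsilon> f = c \<epsilon> g \<Longrightarrow> C2_dist f g < \<epsilon>"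
    by metis
  define e where "e n = 1 / real (Suc n)" for n
  have e: "0 < e n" for n by (simp add: e_def)
  define R where "R n = inv_into C2p (c (e n)) ` (c (e n) ` C2p)" for n
  show thesis
  proof (rule that[of "\<Union>n. R n"])
    have "countable (R n)" for n unfolding R_def by (rule countable_image) (rule countableI_type)
    then show "countable (\<Union>n. R n)" by simp
    show "(\<Union>n. R n) \<subseteq> C2p" by (auto simp: R_def inv_into_into)
    fix f \<epsilon> assume f: "f \<in> C2p" and "0 < (\<epsilon> :: real)"
    then obtain n where n: "e n < \<epsilon>" unfolding e_def by (metis nat_approx_posE)
    let ?g = "inv_into C2p (c (e n)) (c (e n) f)"
    have im: "c (e n) f \<in> c (e n) ` C2p" using f by simp
    have "C2_dist ?g f < e n"
      by (rule c[OF e inv_into_into[OF im] f f_inv_into_f[OF im]])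
    moreover have "?g \<in> R n" using f unfolding R_def by (intro imageI)
    ultimately show "\<exists>g\<in>\<Union>n. R n. C2_dist g f < \<epsilon>" using n by force
  qed
qed

lemma space_C2p_borel [simp]: "space C2p_borel = C2p"
  using Metric_space.openin_mtopology[OF Metric_space_C2p]
  by (auto simp: C2p_borel_def intro!: space_measure_of)

text \<open>
  By separability an open set is a countable union of balls, and the distance to a fixed curve is a
  measurable function of the evaluations.
\<close>

lemma measurable_C2p_borelI:
  assumes h: "\<And>\<omega>. \<omega> \<in> space N \<Longrightarrow> h \<omega> \<in> C2p"
    and m: "\<And>s. (\<lambda>\<omega>. h \<omega> s) \<in> borel_measurable N"
  shows "h \<in> N \<rightarrow>\<^sub>M C2p_borel"
proof -
  interpret C: Metric_space C2p C2_dist by (rule Metric_space_C2p)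
  obtain D where D: "countable D" "D \<subseteq> C2p" "\<And>f \<epsilon>. f \<in> C2p \<Longrightarrow> 0 < \<epsilon> \<Longrightarrow> \<exists>g\<in>D. C2_dist g f < \<epsilon>"
    using C2p_separable by blast
  have ball: "{\<omega>\<in>space N. C2_dist d (h \<omega>) < r} \<in> sets N" if "d \<in> D" for d r
    using C2_dist_measurable[OF _ h m, of d] that D(2) by (simp add: borel_measurable_iff_less subset_eq)
  show ?thesis
    unfolding C2p_borel_def
  proof (rule measurable_measure_of)
    show "{U. openin C.mtopology U} \<subseteq> Pow C2p" by (auto simp: C.openin_mtopology)
    show "h \<in> space N \<rightarrow> C2p" using h by auto
    fix U assume "U \<in> {U. openin C.mtopology U}"
    then have U: "U \<subseteq> C2p" "\<And>f. f \<in> U \<Longrightarrow> \<exists>r>0. C.mball f r \<subseteq> U" by (auto simp: C.openin_mtopology)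
    define I where "I = {(d, n). d \<in> D \<and> C.mball d (1 / real (Suc n)) \<subseteq> U}"
    have I: "countable I"
      by (rule countable_subset[of _ "D \<times> UNIV"]) (auto simp: I_def D(1))
    have "h -` U \<inter> space N = (\<Union>(d, n)\<in>I. {\<omega>\<in>space N. C2_dist d (h \<omega>) < 1 / real (Suc n)})"
    proof (intro subset_antisym subsetI)
      fix \<omega> assume "\<omega> \<in> h -` U \<inter> space N"
      then have \<omega>: "\<omega> \<in> space N" "h \<omega> \<in> U" "h \<omega> \<in> C2p" using U(1) by auto
      then obtain r where r: "0 < r" "C.mball (h \<omega>) r \<subseteq> U" using U(2) by blast
      then obtain n where n: "1 / real (Suc n) < r / 2" by (metis half_gt_zero nat_approx_posE)
      obtain d where d: "d \<in> D" "C2_dist d (h \<omega>) < 1 / real (Suc n)"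
        using D(3)[OF \<omega>(3), of "1 / real (Suc n)"] by auto
      have "C.mball d (1 / real (Suc n)) \<subseteq> C.mball (h \<omega>) r"
      proof
        fix g assume g: "g \<in> C.mball d (1 / real (Suc n))"
        then have "g \<in> C2p" "d \<in> C2p" "C2_dist d g < 1 / real (Suc n)" by auto
        then have "C2_dist (h \<omega>) g < r"
          using C.triangle[of "h \<omega>" d g] C.commute[of "h \<omega>" d] \<omega>(3) d(2) n by simp
        then show "g \<in> C.mball (h \<omega>) r" using \<open>g \<in> C2p\<close> \<omega>(3) by simp
      qed
      then have "(d, n) \<in> I" using r(2) d(1) by (auto simp: I_def)
      then show "\<omega> \<in> (\<Union>(d, n)\<in>I. {\<omega>\<in>space N. C2_dist d (h \<omega>) < 1 / real (Suc n)})"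
        using d(2) \<omega>(1) by force
    next
      fix \<omega> assume "\<omega> \<in> (\<Union>(d, n)\<in>I. {\<omega>\<in>space N. C2_dist d (h \<omega>) < 1 / real (Suc n)})"
      then obtain d n where "(d, n) \<in> I" "\<omega> \<in> space N" "C2_dist d (h \<omega>) < 1 / real (Suc n)" by auto
      moreover from this have "h \<omega> \<in> C.mball d (1 / real (Suc n))"
        using D(2) h by (auto simp: I_def)
      ultimately show "\<omega> \<in> h -` U \<inter> space N" by (auto simp: I_def)
    qed
    also have "\<dots> \<in> sets N"
      using I ball by (intro sets.countable_UN'') (auto simp: I_def)
    finally show "h -` U \<inter> space N \<in> sets N" .
  qed
qed

lemma borel_measurable_vec_nth:
  fixes f :: "'a \<Rightarrow> real ^ 'n"
  assumes "f \<in> borel_measurable M"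
  shows "(\<lambda>x. f x $ i) \<in> borel_measurable M"
  using borel_measurable_inner[OF assms borel_measurable_const[of "axis i 1"]] by (simp add: inner_axis)

lemma borel_measurable_vecI:
  fixes f :: "'a \<Rightarrow> real ^ 'n"
  assumes "\<And>i. (\<lambda>x. f x $ i) \<in> borel_measurable M"
  shows "f \<in> borel_measurable M"
  using assms by (subst borel_measurable_euclidean_space) (auto simp: Basis_vec_def inner_axis)

text \<open>
  The identity is measurable from the \<open>\<sigma>\<close>-algebra generated by the evaluations to the product of the
  Borel \<open>\<sigma>\<close>-algebras, by the criterion for measurability into the space of curves in each factor.
\<close>

lemma sets_PiM_C2p_borel_subset:
  "sets (\<Pi>\<^sub>M t\<in>J. C2p_borel) \<subseteq> sets (vimage_algebra (space (\<Pi>\<^sub>M t\<in>J. C2p_borel))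
     (\<lambda>F. \<lambda>(t, s, i)\<in>J \<times> UNIV \<times> UNIV. F t s $ i) (\<Pi>\<^sub>M k\<in>J \<times> UNIV \<times> UNIV. borel))"
  (is "_ \<subseteq> sets ?N")
proof -
  have e: "(\<lambda>F. \<lambda>(t, s, i)\<in>J \<times> UNIV \<times> UNIV. F t s $ i) \<in> ?N \<rightarrow>\<^sub>M (\<Pi>\<^sub>M k\<in>J \<times> UNIV \<times> UNIV. borel)"
    by (rule measurable_vimage_algebra1) (auto simp: space_PiM)
  have "(\<lambda>F. F t s $ i) \<in> borel_measurable ?N" if "t \<in> J" for t s i
    using measurable_compose[OF e measurable_component_singleton[of "(t, s, i)"]] that by simp
  then have "(\<lambda>F. F t s) \<in> borel_measurable ?N" if "t \<in> J" for t s
    using that by (intro borel_measurable_vecI) auto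
  then have "(\<lambda>F. F t) \<in> ?N \<rightarrow>\<^sub>M C2p_borel" if "t \<in> J" for t
    using that by (intro measurable_C2p_borelI) (auto simp: space_PiM PiE_iff)
  then have "(\<lambda>F. F) \<in> ?N \<rightarrow>\<^sub>M (\<Pi>\<^sub>M t\<in>J. C2p_borel)"
    by (intro measurable_PiM_single') (auto simp: space_PiM)
  then have id: "(\<lambda>F. F) \<in> ?N \<rightarrow>\<^sub>M (\<Pi>\<^sub>M t\<in>J. C2p_borel)" .
  show ?thesis
  proof
    fix A assume A: "A \<in> sets (\<Pi>\<^sub>M t\<in>J. C2p_borel)"
    then have "(\<lambda>F. F) -` A \<inter> space ?N = A"
      using sets.sets_into_space[OF A] by auto
    then show "A \<in> sets ?N" using measurable_sets[OF id A] by simp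
  qed
qed

lemma distr_C2p_process_eqI:
  fixes X :: "real \<Rightarrow> 'a \<Rightarrow> real \<Rightarrow> real ^ 3" and Y :: "real \<Rightarrow> 'b \<Rightarrow> real \<Rightarrow> real ^ 3"
  assumes X: "\<And>t. t \<in> J \<Longrightarrow> X t \<in> M \<rightarrow>\<^sub>M C2p_borel" and Y: "\<And>t. t \<in> J \<Longrightarrow> Y t \<in> N \<rightarrow>\<^sub>M C2p_borel"
    and Xs: "\<And>t s. t \<in> J \<Longrightarrow> (\<lambda>\<omega>. X t \<omega> s) \<in> borel_measurable M"
    and Ys: "\<And>t s. t \<in> J \<Longrightarrow> (\<lambda>\<omega>. Y t \<omega> s) \<in> borel_measurable N"
    and eq: "distr M (\<Pi>\<^sub>M k\<in>J \<times> UNIV \<times> UNIV. borel) (\<lambda>\<omega>. \<lambda>(t, s, i)\<in>J \<times> UNIV \<times> UNIV. X t \<omega> s $ i)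
      = distr N (\<Pi>\<^sub>M k\<in>J \<times> UNIV \<times> UNIV. borel) (\<lambda>\<omega>. \<lambda>(t, s, i)\<in>J \<times> UNIV \<times> UNIV. Y t \<omega> s $ i)"
  shows "distr M (\<Pi>\<^sub>M t\<in>J. C2p_borel) (\<lambda>\<omega>. \<lambda>t\<in>J. X t \<omega>) = distr N (\<Pi>\<^sub>M t\<in>J. C2p_borel) (\<lambda>\<omega>. \<lambda>t\<in>J. Y t \<omega>)"
proof (rule measure_eqI)
  let ?P = "\<Pi>\<^sub>M t\<in>J. C2p_borel"
  let ?E = "\<Pi>\<^sub>M k\<in>J \<times> UNIV \<times> (UNIV :: 3 set). (borel :: real measure)"
  let ?e = "\<lambda>F :: real \<Rightarrow> real \<Rightarrow> real ^ 3. \<lambda>(t, s, i)\<in>J \<times> UNIV \<times> UNIV. F t s $ i"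
  fix A assume "A \<in> sets (distr M ?P (\<lambda>\<omega>. \<lambda>t\<in>J. X t \<omega>))"
  then have A: "A \<in> sets ?P" by simp
  have e: "?e \<in> space ?P \<rightarrow> space ?E" by (auto simp: space_PiM)
  obtain B where B: "B \<in> sets ?E" "A = ?e -` B \<inter> space ?P"
  proof -
    have "A \<in> sets (vimage_algebra (space ?P) ?e ?E)" using A sets_PiM_C2p_borel_subset by blast
    then show thesis using that unfolding sets_vimage_algebra2[OF e] by blast
  qed
  have em: "emeasure (distr L ?P (\<lambda>\<omega>. \<lambda>t\<in>J. Z t \<omega>)) A
      = emeasure (distr L ?E (\<lambda>\<omega>. \<lambda>(t, s, i)\<in>J \<times> UNIV \<times> UNIV. Z t \<omega> s $ i)) B"
    if Z: "\<And>t. t \<in> J \<Longrightarrow> Z t \<in> L \<rightarrow>\<^sub>M C2p_borel"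
      and Zs: "\<And>t s. t \<in> J \<Longrightarrow> (\<lambda>\<omega>. Z t \<omega> s) \<in> borel_measurable L" for Z and L :: "'c measure"
  proof -
    have m1: "(\<lambda>\<omega>. \<lambda>t\<in>J. Z t \<omega>) \<in> L \<rightarrow>\<^sub>M ?P" using Z by (intro measurable_restrict)
    have m2: "(\<lambda>\<omega>. \<lambda>(t, s, i)\<in>J \<times> UNIV \<times> UNIV. Z t \<omega> s $ i) \<in> L \<rightarrow>\<^sub>M ?E"
      using Zs by (intro measurable_restrict) (auto intro!: borel_measurable_vec_nth)
    have "?e (\<lambda>t\<in>J. Z t \<omega>) = (\<lambda>(t, s, i)\<in>J \<times> UNIV \<times> UNIV. Z t \<omega> s $ i)" for \<omega>
      by (auto simp: fun_eq_iff)
    then have "(\<lambda>\<omega>. \<lambda>t\<in>J. Z t \<omega>) -` A \<inter> space L = (\<lambda>\<omega>. \<lambda>(t, s, i)\<in>J \<times> UNIV \<times> UNIV. Z t \<omega> s $ i) -` B \<inter> space L"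
      using measurable_space[OF m1] by (auto simp: B(2))
    then show ?thesis unfolding emeasure_distr[OF m1 A] emeasure_distr[OF m2 B(1)] by simp
  qed
  show "emeasure (distr M ?P (\<lambda>\<omega>. \<lambda>t\<in>J. X t \<omega>)) A = emeasure (distr N ?P (\<lambda>\<omega>. \<lambda>t\<in>J. Y t \<omega>)) A"
    using em[OF X Xs] em[OF Y Ys] eq by simp
qed simp

section \<open>Stationarity\<close>

lemma C2pI:
  assumes "\<And>s. f (s + 2 * pi) = f s" "\<And>s. (f has_vector_derivative f' s) (at s)"
    "\<And>s. (f' has_vector_derivative f'' s) (at s)" "continuous_on UNIV f''"
  shows "f \<in> C2p"
  using assms unfolding C2p_def by blast

lemma zero_in_C2p: "(\<lambda>_. 0) \<in> C2p"
  by (auto simp: C2p_def intro!: exI[of _ "\<lambda>_. 0"])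

lemma affine_image_C2p:
  assumes "f \<in> C2p"
  shows "(\<lambda>s. a + Q *v f s) \<in> C2p"
proof -
  note f = C2p_derivs[OF assms]
  have "bounded_linear ((*v) Q)" by simp
  note Q = bounded_linear.has_vector_derivative[OF this]
  have "((\<lambda>s. a + Q *v f s) has_vector_derivative Q *v vderiv f s) (at s)" for s
    using has_vector_derivative_add[OF has_vector_derivative_const[of a] Q[OF f(1)[of s]]] by simp
  moreover have "((\<lambda>s. Q *v vderiv f s) has_vector_derivative Q *v vderiv (vderiv f) s) (at s)" for s
    by (rule Q[OF f(2)])
  moreover have "continuous_on UNIV (\<lambda>s. Q *v vderiv (vderiv f) s)"
    using linear_continuous_on_compose[OF f(5) matrix_vector_mul_linear] .
  ultimately show ?thesis using f(6) by (intro C2pI) simp_all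
qed

text \<open>
  Chain rule in terms of the partial derivatives, which are what the recursive definition of
  smoothness speaks of.
\<close>

lemma has_vector_derivative_compose_partials:
  fixes F :: "'a :: euclidean_space \<Rightarrow> 'b :: real_normed_vector"
  assumes F: "F differentiable (at (p s))" and p: "(p has_vector_derivative p') (at s)"
  shows "((\<lambda>s. F (p s)) has_vector_derivative (\<Sum>b\<in>Basis. (p' \<bullet> b) *\<^sub>R frechet_derivative F (at (p s)) b)) (at s)"
proof -
  let ?D = "frechet_derivative F (at (p s))"
  have D: "(F has_derivative ?D) (at (p s))" using F by (simp add: frechet_derivative_works)
  have "((F \<circ> p) has_vector_derivative ?D p') (at s)"
    using vector_derivative_diff_chain_within[of p p' s UNIV F ?D] p D by (simp add: has_derivative_at_withinI)
  moreover have "?D p' = (\<Sum>b\<in>Basis. (p' \<bullet> b) *\<^sub>R ?D b)"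
  proof -
    have l: "linear ?D" using D by (rule has_derivative_linear)
    have "?D p' = ?D (\<Sum>b\<in>Basis. (p' \<bullet> b) *\<^sub>R b)" by (simp add: euclidean_representation)
    also have "\<dots> = (\<Sum>b\<in>Basis. (p' \<bullet> b) *\<^sub>R ?D b)"
      by (simp add: linear_sum[OF l] linear_scale[OF l])
    finally show ?thesis .
  qed
  ultimately show ?thesis by (simp add: comp_def)
qed

lemma smooth_continuous: "smooth F \<Longrightarrow> continuous_on UNIV F"
  unfolding smooth_def by (metis Ck.simps(1))

lemma smooth_compose_C2p:
  assumes F: "smooth F" and p: "p \<in> C2p"
  shows "(\<lambda>s. F (p s)) \<in> C2p"
proof -
  note p = C2p_derivs[OF p]
  have "Ck (Suc (Suc 0)) F" using F unfolding smooth_def by blast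
  then have F1: "\<And>x. F differentiable (at x)"
    and F2: "\<And>b x. b \<in> Basis \<Longrightarrow> (\<lambda>x. frechet_derivative F (at x) b) differentiable (at x)"
    and F3: "\<And>b b'. b \<in> Basis \<Longrightarrow> b' \<in> Basis \<Longrightarrow>
      continuous_on UNIV (\<lambda>x. frechet_derivative (\<lambda>x. frechet_derivative F (at x) b) (at x) b')"
    by auto
  define F' where "F' b x = frechet_derivative F (at x) b" for b x
  define F'' where "F'' b b' x = frechet_derivative (F' b) (at x) b'" for b b' x
  have F': "continuous_on UNIV (F' b)" "\<And>x. F' b differentiable (at x)" if "b \<in> Basis" for b
    using F2[OF that] unfolding F'_def
    by (auto simp: continuous_on_eq_continuous_within intro: differentiable_imp_continuous_within)
  have F'': "continuous_on UNIV (F'' b b')" if "b \<in> Basis" "b' \<in> Basis" for b b'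
    using F3[OF that] by (simp add: F''_def F'_def[abs_def])
  have comp: "continuous_on UNIV (\<lambda>s. G (p s))" if "continuous_on UNIV G" for G :: "real ^ 3 \<Rightarrow> real ^ 3"
    using continuous_on_compose2[OF that p(3)] by simp
  let ?d1 = "\<lambda>s. \<Sum>b\<in>Basis. (vderiv p s \<bullet> b) *\<^sub>R F' b (p s)"
  let ?d2 = "\<lambda>s. \<Sum>b\<in>Basis. (vderiv p s \<bullet> b) *\<^sub>R (\<Sum>b'\<in>Basis. (vderiv p s \<bullet> b') *\<^sub>R F'' b b' (p s))
      + (vderiv (vderiv p) s \<bullet> b) *\<^sub>R F' b (p s)"
  have "((\<lambda>s. F (p s)) has_vector_derivative ?d1 s) (at s)" for s
    unfolding F'_def by (rule has_vector_derivative_compose_partials[OF F1 p(1)])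
  moreover have "(?d1 has_vector_derivative ?d2 s) (at s)" for s
  proof (rule has_vector_derivative_sum)
    fix b :: "real ^ 3" assume b: "b \<in> Basis"
    have "((\<lambda>s. vderiv p s \<bullet> b) has_vector_derivative vderiv (vderiv p) s \<bullet> b) (at s)"
      by (rule bounded_linear.has_vector_derivative[OF bounded_linear_inner_left p(2)])
    moreover have "((\<lambda>s. F' b (p s)) has_vector_derivative (\<Sum>b'\<in>Basis. (vderiv p s \<bullet> b') *\<^sub>R F'' b b' (p s))) (at s)"
      unfolding F''_def by (rule has_vector_derivative_compose_partials[OF F'(2)[OF b] p(1)])
    ultimately show "((\<lambda>s. (vderiv p s \<bullet> b) *\<^sub>R F' b (p s)) has_vector_derivative
        (vderiv p s \<bullet> b) *\<^sub>R (\<Sum>b'\<in>Basis. (vderiv p s \<bullet> b') *\<^sub>R F'' b b' (p s))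
        + (vderiv (vderiv p) s \<bullet> b) *\<^sub>R F' b (p s)) (at s)"
      by (rule bounded_bilinear.has_vector_derivative[OF bounded_bilinear_scaleR])
  qed
  moreover have "continuous_on UNIV ?d2"
    by (intro continuous_on_sum continuous_on_add continuous_on_scaleR continuous_on_inner
        continuous_on_const comp p F' F'')
  ultimately show ?thesis by (rule C2pI[rotated]) (simp add: p(6))
qed

lemma xi_char_cong_norm:
  assumes "\<And>k l. k \<in> K \<Longrightarrow> l \<in> K \<Longrightarrow> norm (a k - a l) = norm (b k - b l)"
  shows "xi_char K c a = xi_char K c b"
  using assms unfolding xi_char_def by (simp cong: sum.cong)

text \<open>
  Here \<open>\<tau>\<close> disappears. The points at the times \<open>t k + \<tau>\<close> arise by one random rigid motion
  from the points \<open>U (t k) *v a k + Q *v (w (t k + \<tau>) \<omega> - w \<tau> \<omega>)\<close>, where \<open>Q\<close> is the inverse of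
  \<open>U \<tau>\<close>. Rigid motions do not change \<open>xi_char\<close>, and
  the rotated increments have the law of \<open>w r \<omega> - w 0 \<omega>\<close>.
\<close>

lemma xi_along_flow_iexp:
  fixes M :: "'w measure" and \<xi> :: "real ^ 3 \<Rightarrow> 'w \<Rightarrow> real ^ 3" and a :: "'k \<Rightarrow> real ^ 3"
  assumes M: "prob_space M" and \<xi>: "xi_field M \<xi>" and w: "wiener_process M w"
    and indep: "indep_field_process M \<xi> w" and flow: "orthogonal_flow A U"
    and \<tau>: "0 \<le> \<tau>" and K: "finite K" and t: "\<And>k. k \<in> K \<Longrightarrow> 0 \<le> t k"
    and Z: "\<And>k. k \<in> K \<Longrightarrow> Z k \<in> borel_measurable M"
    and Z\<xi>: "\<And>k. k \<in> K \<Longrightarrow> AE \<omega> in M. Z k \<omega> = \<xi> (m + U (t k + \<tau>) *v a k + w (t k + \<tau>) \<omega>) \<omega>"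
  shows "(\<integral>\<omega>. iexp (\<Sum>k\<in>K. c k \<bullet> Z k \<omega>) \<partial>M)
    = complex_of_real (\<integral>y. xi_char K c (\<lambda>k. U (t k) *v a k + y (t k))
        \<partial>distr M (\<Pi>\<^sub>M r\<in>t ` K. borel) (\<lambda>\<omega>. \<lambda>r\<in>t ` K. w r \<omega> - w 0 \<omega>))"
proof -
  interpret prob_space M by fact
  define Q where "Q = transpose (U \<tau>)"
  have U\<tau>: "orthogonal_matrix (U \<tau>)" using flow_orthogonal[OF flow \<tau>] .
  then have Q: "orthogonal_matrix Q" "U \<tau> ** Q = mat 1"
    by (simp_all add: Q_def orthogonal_matrix_def)
  have J: "finite (t ` K)" "t ` K \<subseteq> {0..}" using K t by auto
  have cont: "AE \<omega> in M. continuous_on UNIV (\<lambda>u. \<xi> u \<omega>)"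
    using \<xi> unfolding xi_field_def by (auto elim!: eventually_mono intro: smooth_continuous)
  have wM: "w r \<in> borel_measurable M" if "0 \<le> r" for r using wiener_process_measurable[OF w that] .
  let ?P = "\<Pi>\<^sub>M r\<in>t ` K. (borel :: (real ^ 3) measure)"
  let ?\<Psi> = "\<lambda>y. xi_char K c (\<lambda>k. U (t k) *v a k + y (t k))"
  have [measurable]: "(\<lambda>y. y (t k)) \<in> borel_measurable ?P" if "k \<in> K" for k
    using that by (intro measurable_component_singleton) auto
  have \<Psi> [measurable]: "?\<Psi> \<in> borel_measurable ?P"
    unfolding xi_char_def by measurable
  have QM [measurable]: "(*v) Q \<in> borel_measurable borel"
    by (rule borel_measurable_matrix_vector_mult)
  have m1: "(\<lambda>\<omega>. \<lambda>r\<in>t ` K. Q *v (w (r + \<tau>) \<omega> - w \<tau> \<omega>)) \<in> M \<rightarrow>\<^sub>M ?P"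
    using t \<tau> by (intro measurable_restrict measurable_compose[OF _ QM] borel_measurable_diff wM) auto
  have "(\<integral>\<omega>. iexp (\<Sum>k\<in>K. c k \<bullet> Z k \<omega>) \<partial>M)
      = complex_of_real (\<integral>\<omega>. xi_char K c (\<lambda>k. m + U (t k + \<tau>) *v a k + w (t k + \<tau>) \<omega>) \<partial>M)"
  proof (rule xi_iexp_random[OF indep \<xi> K _ Z Z\<xi> cont])
    fix k assume "k \<in> K"
    then show "(\<lambda>\<omega>. m + U (t k + \<tau>) *v a k + w (t k + \<tau>) \<omega>) \<in> borel_measurable (process_algebra M w)"
      using t \<tau> by (intro borel_measurable_add borel_measurable_const process_algebra_measurable) auto
  qed
  also have "(\<lambda>\<omega>. xi_char K c (\<lambda>k. m + U (t k + \<tau>) *v a k + w (t k + \<tau>) \<omega>))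
      = (\<lambda>\<omega>. ?\<Psi> (\<lambda>r\<in>t ` K. Q *v (w (r + \<tau>) \<omega> - w \<tau> \<omega>)))"
  proof (intro ext xi_char_cong_norm)
    fix \<omega> k l assume kl: "k \<in> K" "l \<in> K"
    \<comment> \<open>The common rigid motion: rotation by \<open>U \<tau>\<close> and shift by \<open>m + w \<tau> \<omega>\<close>.\<close>
    have move: "m + U (t j + \<tau>) *v a j + w (t j + \<tau>) \<omega>
        = m + w \<tau> \<omega> + U \<tau> *v (U (t j) *v a j + Q *v (w (t j + \<tau>) \<omega> - w \<tau> \<omega>))" if "j \<in> K" for j
      using flow_add[OF flow t[OF that] \<tau>, of "a j"]
      by (simp add: matrix_vector_right_distrib matrix_vector_mul_assoc Q add.commute[of "t j"])
    show "norm (m + U (t k + \<tau>) *v a k + w (t k + \<tau>) \<omega> - (m + U (t l + \<tau>) *v a l + w (t l + \<tau>) \<omega>))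
      = norm (U (t k) *v a k + (\<lambda>r\<in>t ` K. Q *v (w (r + \<tau>) \<omega> - w \<tau> \<omega>)) (t k)
          - (U (t l) *v a l + (\<lambda>r\<in>t ` K. Q *v (w (r + \<tau>) \<omega> - w \<tau> \<omega>)) (t l)))"
      unfolding move[OF kl(1)] move[OF kl(2)]
      using kl norm_orthogonal_matrix[OF U\<tau>]
      by (simp flip: matrix_vector_mult_diff_distrib)
  qed
  also have "(\<integral>\<omega>. ?\<Psi> (\<lambda>r\<in>t ` K. Q *v (w (r + \<tau>) \<omega> - w \<tau> \<omega>)) \<partial>M)
      = (\<integral>y. ?\<Psi> y \<partial>distr M ?P (\<lambda>\<omega>. \<lambda>r\<in>t ` K. Q *v (w (r + \<tau>) \<omega> - w \<tau> \<omega>)))"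
    by (rule integral_distr[OF m1 \<Psi>, symmetric])
  finally show ?thesis
    unfolding wiener_rotated_increments[OF M w Q(1) J \<tau>] .
qed

theorem theorem3p1:
  fixes M :: "'w measure"
    and \<xi> :: "real ^ 3 \<Rightarrow> 'w \<Rightarrow> real ^ 3"
    and w :: "real \<Rightarrow> 'w \<Rightarrow> real ^ 3"
    and A :: "real ^ 3 ^ 3"
    and f\<^sub>0 :: "real \<Rightarrow> real ^ 3"
    and x :: "real ^ 3 \<Rightarrow> real \<Rightarrow> 'w \<Rightarrow> real ^ 3"
  assumes "prob_space M"
    and "xi_field M \<xi>"
    and "wiener_process M w"
    and "indep_field_process M \<xi> w"
    and "generates_orthogonal_group A"
    and "f\<^sub>0 \<in> C2p"
    and "interaction_solution M A (visitation_measure f\<^sub>0) w x"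
  shows "stationary_process_ae M C2p_borel (\<lambda>t \<omega> s. \<xi> (x (f\<^sub>0 s) t \<omega>) \<omega>)"
proof -
  interpret prob_space M by fact
  note \<xi> = \<open>xi_field M \<xi>\<close> and w = \<open>wiener_process M w\<close>
  obtain U where flow: "orthogonal_flow A U"
    using \<open>generates_orthogonal_group A\<close> unfolding generates_orthogonal_group_def orthogonal_flow_def by blast
  let ?\<mu> = "visitation_measure f\<^sub>0"
  define m where "m = (\<integral>v. v \<partial>?\<mu>)"
  define p where "p t \<omega> s = m + U t *v (f\<^sub>0 s - m) + w t \<omega>" for t \<omega> s
  have p_C2p: "p t \<omega> \<in> C2p" for t \<omega>
  proof -
    have "p t \<omega> = (\<lambda>s. (m - U t *v m + w t \<omega>) + U t *v f\<^sub>0 s)"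
      by (simp add: p_def fun_eq_iff matrix_vector_mult_diff_distrib)
    then show ?thesis using affine_image_C2p[OF \<open>f\<^sub>0 \<in> C2p\<close>] by simp
  qed
  have "AE \<omega> in M. smooth (\<lambda>u. \<xi> u \<omega>) \<and> (\<forall>u. \<forall>t\<ge>0. x u t \<omega> = m + U t *v (u - m) + w t \<omega>)"
  proof -
    have "AE \<omega> in M. smooth (\<lambda>u. \<xi> u \<omega>)" using \<xi> unfolding xi_field_def by blast
    moreover have "AE \<omega> in M. \<forall>u. \<forall>t\<ge>0. x u t \<omega> = m + U t *v (u - m) + w t \<omega>"
      using \<open>interaction_solution M A ?\<mu> w x\<close>[unfolded interaction_solution_def, THEN conjunct2]
    proof eventually_elim
      case (elim \<omega>)
      then show ?case
        unfolding m_def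
        by (intro allI impI interaction_solution_eq[OF flow prob_space_visitation_measure[OF \<open>f\<^sub>0 \<in> C2p\<close>]]) blast+
    qed
    ultimately show ?thesis by simp
  qed
  then obtain N where N: "N \<in> null_sets M"
    and good: "\<And>\<omega>. \<omega> \<in> space M - N \<Longrightarrow> smooth (\<lambda>u. \<xi> u \<omega>)"
      "\<And>\<omega> u t. \<omega> \<in> space M - N \<Longrightarrow> t \<ge> 0 \<Longrightarrow> x u t \<omega> = m + U t *v (u - m) + w t \<omega>"
    by (elim AE_E3) blast
  have off_N: "AE \<omega> in M. \<omega> \<in> space M - N" using AE_not_in[OF N] AE_space by eventually_elim auto
  have G [measurable]: "space M - N \<in> events" using N by auto
  \<comment> \<open>The version of the process: on the null set the curve is replaced by the zero curve, which keeps
    every value in the space of curves and every evaluation measurable.\<close>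
  define Y where "Y t \<omega> = (if \<omega> \<in> space M - N then (\<lambda>s. \<xi> (p t \<omega> s) \<omega>) else (\<lambda>_. 0))" for t \<omega>
  have Y_C2p: "Y t \<omega> \<in> C2p" for t \<omega>
    using smooth_compose_C2p[OF good(1) p_C2p] zero_in_C2p by (simp add: Y_def)
  have Ys: "(\<lambda>\<omega>. Y t \<omega> s) \<in> borel_measurable M" if "0 \<le> t" for t s
  proof -
    obtain d :: "nat \<Rightarrow> real ^ 3 \<Rightarrow> real ^ 3"
      where d: "\<And>n. simple_function borel (d n)" "\<And>x. (\<lambda>n. d n x) \<longlonglongrightarrow> x"
      using simple_functions_tendsto_id by blast
    have pM: "(\<lambda>\<omega>. p t \<omega> s) \<in> borel_measurable M"
      unfolding p_def by (intro borel_measurable_add borel_measurable_const wiener_process_measurable[OF w that])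
    show ?thesis
    proof (rule borel_measurable_LIMSEQ_metric)
      show "(\<lambda>\<omega>. indicator (space M - N) \<omega> *\<^sub>R \<xi> (d n (p t \<omega> s)) \<omega>) \<in> borel_measurable M" for n
        by (intro borel_measurable_scaleR borel_measurable_indicator G
            xi_at_simple_point_measurable[OF xi_measurable[OF \<xi>] d(1) pM])
      fix \<omega> assume "\<omega> \<in> space M"
      show "(\<lambda>n. indicator (space M - N) \<omega> *\<^sub>R \<xi> (d n (p t \<omega> s)) \<omega>) \<longlonglongrightarrow> Y t \<omega> s"
      proof (cases "\<omega> \<in> N")
        case False
        then have "\<omega> \<in> space M - N" using \<open>\<omega> \<in> space M\<close> by simp
        moreover from this have "(\<lambda>n. \<xi> (d n (p t \<omega> s)) \<omega>) \<longlonglongrightarrow> \<xi> (p t \<omega> s) \<omega>"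
          using continuous_on_tendsto_compose[OF smooth_continuous[OF good(1)] d(2)[of "p t \<omega> s"]] by simp
        ultimately show ?thesis by (simp add: Y_def)
      qed (simp add: Y_def)
    qed
  qed
  have Y: "Y t \<in> M \<rightarrow>\<^sub>M C2p_borel" if "0 \<le> t" for t
    using Y_C2p Ys[OF that] by (intro measurable_C2p_borelI)
  have iexp_Y: "(\<integral>\<omega>. iexp (\<Sum>k\<in>K. c k * (case k of (t, s, i) \<Rightarrow> Y (t + \<tau>) \<omega> s $ i)) \<partial>M)
      = complex_of_real (\<integral>y. xi_char K (\<lambda>k. axis (snd (snd k)) (c k)) (\<lambda>k. U (fst k) *v (f\<^sub>0 (fst (snd k)) - m) + y (fst k))
        \<partial>distr M (\<Pi>\<^sub>M r\<in>fst ` K. borel) (\<lambda>\<omega>. \<lambda>r\<in>fst ` K. w r \<omega> - w 0 \<omega>))"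
    if "0 \<le> \<tau>" "finite K" "fst ` K \<subseteq> {0..}" for \<tau> and K :: "(real \<times> real \<times> 3) set" and c
  proof -
    have "c k * (case k of (t, s, i) \<Rightarrow> Y (t + \<tau>) \<omega> s $ i)
        = axis (snd (snd k)) (c k) \<bullet> Y (fst k + \<tau>) \<omega> (fst (snd k))" for k \<omega>
      by (simp add: inner_axis' split: prod.split)
    moreover have "0 \<le> fst k" if "k \<in> K" for k using that \<open>fst ` K \<subseteq> {0..}\<close> by auto
    moreover have "AE \<omega> in M. Y t \<omega> s = \<xi> (m + U t *v (f\<^sub>0 s - m) + w t \<omega>) \<omega>" for t s
      using off_N by eventually_elim (simp add: Y_def p_def)
    ultimately show ?thesis
      using that Ys
      by (simp only:) (rule xi_along_flow_iexp[OF \<open>prob_space M\<close> \<xi> w \<open>indep_field_process M \<xi> w\<close> flow, where m = m]; simp)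
  qed
  have "stationary_process M C2p_borel Y"
    unfolding stationary_process_def
  proof (intro conjI allI impI Y; (elim conjE)?)
    fix \<tau> :: real and J :: "real set" assume \<tau>: "0 \<le> \<tau>" and J: "finite J" "J \<subseteq> {0..}"
    show "distr M (\<Pi>\<^sub>M t\<in>J. C2p_borel) (\<lambda>\<omega>. \<lambda>t\<in>J. Y (t + \<tau>) \<omega>) = distr M (\<Pi>\<^sub>M t\<in>J. C2p_borel) (\<lambda>\<omega>. \<lambda>t\<in>J. Y t \<omega>)"
    proof (intro distr_C2p_process_eqI Y Ys)
      let ?I = "J \<times> UNIV \<times> (UNIV :: 3 set)"
      show "distr M (\<Pi>\<^sub>M k\<in>?I. borel) (\<lambda>\<omega>. \<lambda>(t, s, i)\<in>?I. Y (t + \<tau>) \<omega> s $ i)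
          = distr M (\<Pi>\<^sub>M k\<in>?I. borel) (\<lambda>\<omega>. \<lambda>(t, s, i)\<in>?I. Y t \<omega> s $ i)"
      proof (rule distr_process_eqI)
        fix K :: "(real \<times> real \<times> 3) set" and c assume K: "finite K" "K \<subseteq> ?I"
        then have "fst ` K \<subseteq> {0..}" using J by auto
        then show "(\<integral>\<omega>. iexp (\<Sum>k\<in>K. c k * (case k of (t, s, i) \<Rightarrow> Y (t + \<tau>) \<omega> s $ i)) \<partial>M)
            = (\<integral>\<omega>. iexp (\<Sum>k\<in>K. c k * (case k of (t, s, i) \<Rightarrow> Y t \<omega> s $ i)) \<partial>M)"
          using iexp_Y[OF \<tau> K(1), of c] iexp_Y[OF order_refl K(1), of c] by simp
      qed (use J \<tau> finite_measure_axioms in \<open>auto intro!: borel_measurable_vec_nth Ys\<close>)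
    qed (use J \<tau> in auto)
  qed
  moreover have "AE \<omega> in M. \<forall>t\<ge>0. (\<lambda>s. \<xi> (x (f\<^sub>0 s) t \<omega>) \<omega>) = Y t \<omega>"
    using off_N by eventually_elim (simp add: Y_def p_def good(2))
  ultimately show ?thesis unfolding stationary_process_ae_def by blast
qed

end
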